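(* Let $\Omega\subset\mathbb{R}^d$ be open, let $\mathcal{O}=\{A\subset\subset\Omega : A\text{ is open}\}$, let $y\in C(\Omega;\mathbb{R}^d)$ be strictly orientation preserving, and let $U\in\mathcal{O}$. Assume in addition that $\operatorname{deg}(y;U;\cdot)\le 1$ (on $\mathbb{R}^d\setminus y(\partial U)$). Then the following hold. (i) Let $A\in\mathcal{O}$ with $A\subset U$. Then $\operatorname{deg}(y;A;\cdot)\ge 1$ on $y(A)\setminus y(\partial A)$, and $\operatorname{deg}(y;A;\cdot)\le 1$ on $y(A)\setminus[y(\partial A)\cup y(\partial U)]$. If $y(\partial U)$ has empty interior, then $\operatorname{deg}(y;A;\cdot)=1$ on $y(A)\setminus y(\partial A)$. (ii) For all $z\in\operatorname{im}_{\mathrm{loc}}(y;U)\setminus y(\partial U)$, the set $\mathcal{R}_y(U)\cap y^{-1}(\{z\})$ is connected. (iii) If $y(\partial U)$ has empty interior, then $$\operatorname{im}_{\mathrm{loc}}(y;U)\cap y(\partial U)=\emptyset.$$ The latter implies that $\mathcal{R}_y(U)=U\setminus y^{-1}(y(\partial U))$, that $\operatorname{im}_{\mathrm{loc}}(y;U)=y(U)\setminus y(\partial U)=\operatorname{im}_T(y;U)$, and that $y(\partial U)=\partial(\operatorname{im}_{\mathrm{loc}}(y;U))$. If in addition $\Omega$ is bounded and $y\in C(\bar\Omega;\mathbb{R}^d)$, then $U=\Omega$ is also admissible, that is, if $\operatorname{deg}(y;\Omega;\cdot)\le 1$ on $\mathbb{R}^d\setminus y(\partial\Omega)$, then assertions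 (i), (ii) and (iii) hold with $U$ replaced by $\Omega$.
   Context: Throughout $d\in\mathbb{N}$, $d\ge2$. $A_1\subset\subset A_2$ means that $\bar A_1$ is compact and $\bar A_1\subset A_2$. $\operatorname{deg}(y;A;z)\in\mathbb{Z}$ is the Brouwer degree of a continuous $y:\bar A\to\mathbb{R}^d$ on a bounded open set $A$ with respect to $z\in\mathbb{R}^d\setminus y(\partial A)$. For $\Omega\subset\mathbb{R}^d$ open, $\mathcal{O}=\{A\subset\subset\Omega: A\text{ open}\}$ and $y\in C(\Omega;\mathbb{R}^d)$: $y$ is non-degenerate if for each non-empty $V\in\mathcal{O}$ there exist $A\in\mathcal{O}$ with $A\subset V$ and $z\in\mathbb{R}^d\setminus y(\partial A)$ with $\operatorname{deg}(y;A;z)\ne0$; $y$ is orientation preserving if $\operatorname{deg}(y;A;z)\ge0$ for all $A\in\mathcal{O}$ and all $z\in\mathbb{R}^d\setminus y(\partial A)$; $y$ is strictly orientation preserving if it is both non-degenerate and orientation preserving. For $A\in\mathcal{O}$ (or $A=\Omega$ if $\Omega$ is bounded and $y\in C(\bar\Omega;\mathbb{R}^d)$) and $U\subset\Omega$ open define $\operatorname{im}_T(y;A):=\{z\in\mathbb{R}^d\setminus y(\partial A):\operatorname{deg}(y;A;z)\neq0\}$, $\operatorname{im}_{\mathrm{loc}}(y;U):=\bigcup_{A\in\mathcal{O},\,A\subset U}\operatorname{im}_T(y;A)$, and the (topologically) reduced domain $\mathcal{R}_y(U):=\{x\in U:\exists A\in\mathcal{O}\text{ with }x\in A\subset U\text{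 and }y(x)\notin y(\partial A)\}$. *)

theory Defs
  imports "HOL-Analysis.Analysis" "HOL-Homology.Homology"
begin

section \<open>The Brouwer degree on bounded open sets\<close>

text \<open>
  The library provides the Brouwer degree of self-maps of the sphere
  (\<^const>\<open>Brouwer_degree2\<close>).  We transport it to self-maps of the one-point compactification
  of \<open>\<real>\<^sup>d\<close>, the point at infinity being \<^const>\<open>None\<close>.  The same homeomorphism with the
  sphere is used in the domain and in the codomain, so the value does not depend on its choice
  and the identity has degree \<open>1\<close> (lemmas \<open>compactification_degree_eq\<close> and
  \<open>compactification_degree_id\<close> below).
\<close>

abbreviation compactified :: "(real ^ 'n) option topology" where
  "compactified \<equiv> Alexandroff_compactification euclidean"

definition sphere_coords ::
    "((nat \<Rightarrow> real) \<Rightarrow> (real ^ 'n) option) \<times> ((real ^ 'n) option \<Rightarrow> nat \<Rightarrow> real)" where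
  "sphere_coords =
     (SOME (f, g). homeomorphic_maps (nsphere CARD('n)) (compactified :: (real ^ 'n) option topology) f g)"

definition compactification_degree :: "((real ^ 'n) option \<Rightarrow> (real ^ 'n) option) \<Rightarrow> int" where
  "compactification_degree F =
     Brouwer_degree2 CARD('n) (snd sphere_coords \<circ> F \<circ> fst sphere_coords)"

text \<open>
  Let \<open>z \<notin> y(\<partial>A)\<close> and let \<open>r > 0\<close> be the distance from \<open>z\<close> to \<open>y(\<partial>A)\<close>.  On the part of \<open>A\<close>
  that \<open>y\<close> maps into the ball of radius \<open>r\<close> around \<open>z\<close>, compose \<open>y\<close> with the radial
  orientation preserving homeomorphism \<open>w \<mapsto> (w - z) / (r - \<bar>w - z\<bar>)\<close> of that ball onto \<open>\<real>\<^sup>d\<close>;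
  send all other points, in particular everything outside \<open>A\<close>, to infinity.
  (If \<open>\<partial>A\<close> is empty then so is the bounded open set \<open>A\<close>, and everything is sent to infinity.)
  This is a continuous self-map of the compactification (lemma \<open>continuous_map_collapse\<close>) that
  looks like \<open>y - z\<close>, up to a positive radial factor, near \<open>A \<inter> y\<^sup>-\<^sup>1(z)\<close>, and its degree is the
  Brouwer degree \<open>deg(y; A; z)\<close>.
\<close>

definition collapse ::
    "(real ^ 'n \<Rightarrow> real ^ 'n) \<Rightarrow> (real ^ 'n) set \<Rightarrow> real ^ 'n \<Rightarrow> (real ^ 'n) option \<Rightarrow> (real ^ 'n) option" where
  "collapse y A z p =
     (let r = infdist z (y ` frontier A) in
      case p of
        None \<Rightarrow> None
      | Some x \<Rightarrow>
          if x \<in> A \<and> dist (y x) z < r then Some ((y x - z) /\<^sub>R (r - dist (y x) z)) else None)"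

text \<open>Meaningful for bounded open \<open>A\<close>, \<open>y\<close> continuous on the closure of \<open>A\<close>, and \<open>z \<notin> y(\<partial>A)\<close>.\<close>

definition degree_on :: "(real ^ 'n \<Rightarrow> real ^ 'n) \<Rightarrow> (real ^ 'n) set \<Rightarrow> real ^ 'n \<Rightarrow> int" where
  "degree_on y A z = compactification_degree (collapse y A z)"


subsection \<open>Well-definedness and normalisation\<close>

lemma homeomorphic_space_Alexandroff_compactification:
  assumes X: "compact_space X" "Hausdorff_space X" and a: "a \<in> topspace X"
    and h: "homeomorphic_map (subtopology X (topspace X - {a})) Y h"
  shows "X homeomorphic_space Alexandroff_compactification Y"
proof -
  let ?f = "\<lambda>x. if x = a then None else Some (h x)"
  let ?Xa = "subtopology X (topspace X - {a})"
  have opX: "openin X (topspace X - {a})"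
    using X by (metis Hausdorff_imp_t1_space t1_space_openin_delete_alt openin_topspace)
  have hc: "continuous_map ?Xa Y h" and hs: "h ` (topspace X - {a}) = topspace Y"
    and hi: "inj_on h (topspace X - {a})"
    using h by (auto simp: homeomorphic_eq_everything_map Int_absorb1)
  have hY: "h x \<in> topspace Y" if "x \<in> topspace X" "x \<noteq> a" for x
    using hs that by auto
  have "continuous_map X (Alexandroff_compactification Y) ?f"
    unfolding continuous_map
  proof (intro conjI strip)
    show "?f ` topspace X \<subseteq> topspace (Alexandroff_compactification Y)"
      using hY by auto
    fix V
    assume "openin (Alexandroff_compactification Y) V"
    then consider U where "openin Y U" "V = Some ` U"
      | C where "compactin Y C" "closedin Y C" "V = insert None (Some ` (topspace Y - C))"
      by (auto simp: openin_Alexandroff_compactification)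
    then show "openin X {x \<in> topspace X. ?f x \<in> V}"
    proof cases
      case 1
      have "openin ?Xa {x \<in> topspace ?Xa. h x \<in> U}"
        using hc 1 openin_continuous_map_preimage by blast
      moreover have "{x \<in> topspace X. ?f x \<in> V} = {x \<in> topspace ?Xa. h x \<in> U}"
        using 1 by auto
      ultimately show ?thesis
        using opX openin_trans_full by metis
    next
      case 2
      obtain k where k: "homeomorphic_maps ?Xa Y h k"
        using h homeomorphic_map_maps by blast
      then have kc: "continuous_map Y ?Xa k" and kh: "\<And>x. x \<in> topspace X - {a} \<Longrightarrow> k (h x) = x"
        and hk: "\<And>u. u \<in> topspace Y \<Longrightarrow> h (k u) = u"
        by (auto simp: homeomorphic_maps_def)
      have ki: "k u \<in> topspace X - {a}" if "u \<in> topspace Y" for u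
        using kc that by (fastforce simp: continuous_map_def)
      have CY: "C \<subseteq> topspace Y"
        using 2 closedin_subset by blast
      have "compactin ?Xa (k ` C)"
        using image_compactin 2 kc by blast
      then have "closedin X (k ` C)"
        using X compactin_imp_closedin compactin_subtopology by blast
      moreover have "{x \<in> topspace X. ?f x \<in> V} = topspace X - k ` C"
        unfolding 2 using CY hY kh ki hk by (auto simp: image_iff subset_iff) metis+
      ultimately show ?thesis
        by auto
    qed
  qed
  moreover have "?f ` topspace X = topspace (Alexandroff_compactification Y)"
    using a hs by (auto simp: image_iff)
  moreover have "inj_on ?f (topspace X)"
    using hi by (auto simp: inj_on_def)
  moreover have "Hausdorff_space (Alexandroff_compactification Y)"
  proof -
    have "Hausdorff_space ?Xa" "locally_compact_space ?Xa"
      using X opX by (auto intro: Hausdorff_space_subtopology locally_compact_space_open_subset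
          compact_imp_locally_compact_space)
    then show ?thesis
      unfolding Hausdorff_space_Alexandroff_compactification
      using h homeomorphic_Hausdorff_space homeomorphic_locally_compact_space homeomorphic_map_imp_homeomorphic_space
      by blast
  qed
  ultimately show ?thesis
    using X continuous_imp_homeomorphic_map homeomorphic_map_imp_homeomorphic_space by blast
qed

lemma nsphere_homeomorphic_compactified:
  "nsphere CARD('n) homeomorphic_space (compactified :: (real ^ 'n) option topology)"
proof -
  let ?S = "sphere (0 :: (real ^ 'n) \<times> real) 1"
  have "nsphere (DIM((real ^ 'n) \<times> real) - 1) homeomorphic_space top_of_set (?S \<inter> span Basis)"
    using homeomorphic_maps_nsphere_euclidean_sphere
      [OF independent_Basis orthogonal_Basis refl _ norm_Basis, where ?'n = "(real ^ 'n) \<times> real"]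
    unfolding homeomorphic_space_def by (metis DIM_positive less_irrefl)
  then have 1: "nsphere CARD('n) homeomorphic_space top_of_set ?S"
    by simp
  obtain b :: "(real ^ 'n) \<times> real" where b: "b \<in> ?S"
    by (metis ex_in_conv sphere_eq_empty not_one_less_zero)
  define T :: "((real ^ 'n) \<times> real) set" where "T = UNIV \<times> {0}"
  have T: "subspace T" "dim T = CARD('n)"
  proof -
    show "subspace T"
      unfolding T_def by (simp add: subspace_def zero_prod_def)
    have "dim T = dim (UNIV :: (real ^ 'n) set) + dim {0 :: real}"
      unfolding T_def by (subst dim_Times) auto
    then show "dim T = CARD('n)" by simp
  qed
  have "(?S - {b}) homeomorphic T"
  proof (rule homeomorphic_punctured_sphere_affine)
    show "affine T" using T subspace_imp_affine by blast
    show "aff_dim T + 1 = int DIM((real ^ 'n) \<times> real)"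
      using T by (simp add: aff_dim_subspace)
  qed (use b in auto)
  moreover have "T homeomorphic (UNIV :: (real ^ 'n) set)"
    using T by (intro homeomorphic_subspaces) auto
  ultimately have "(?S - {b}) homeomorphic (UNIV :: (real ^ 'n) set)"
    using homeomorphic_trans by blast
  then have "top_of_set (?S - {b}) homeomorphic_space (euclidean :: (real ^ 'n) topology)"
    using homeomorphic_space_iff_homeomorphic by (metis subtopology_UNIV)
  then obtain h where
    "homeomorphic_map (subtopology (top_of_set ?S) (topspace (top_of_set ?S) - {b}))
        (euclidean :: (real ^ 'n) topology) h"
    by (auto simp: homeomorphic_space subtopology_subtopology Int_absorb1)
  then have "top_of_set ?S homeomorphic_space (compactified :: (real ^ 'n) option topology)"
    by (intro homeomorphic_space_Alexandroff_compactification [where a = b])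
      (use b in \<open>auto simp: compact_space_subtopology Hausdorff_space_subtopology\<close>)
  with 1 show ?thesis
    using homeomorphic_space_trans by blast
qed

lemma homeomorphic_maps_sphere_coords:
  "homeomorphic_maps (nsphere CARD('n)) (compactified :: (real ^ 'n) option topology)
     (fst sphere_coords) (snd sphere_coords)"
proof -
  have "\<exists>p. case p of (f, g) \<Rightarrow>
      homeomorphic_maps (nsphere CARD('n)) (compactified :: (real ^ 'n) option topology) f g"
    using nsphere_homeomorphic_compactified by (auto simp: homeomorphic_space_def)
  from someI_ex [OF this] show ?thesis
    unfolding sphere_coords_def by (simp add: case_prod_unfold)
qed

lemma compactification_degree_eq:
  fixes F :: "(real ^ 'n) option \<Rightarrow> (real ^ 'n) option"
  assumes F: "continuous_map compactified compactified F"
    and fg: "homeomorphic_maps (nsphere CARD('n)) compactified f g"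
  shows "compactification_degree F = Brouwer_degree2 CARD('n) (g \<circ> F \<circ> f)"
proof -
  let ?S = "nsphere CARD('n)" and ?D = "Brouwer_degree2 CARD('n)"
  let ?f = "fst sphere_coords :: (nat \<Rightarrow> real) \<Rightarrow> (real ^ 'n) option"
  let ?g = "snd sphere_coords :: (real ^ 'n) option \<Rightarrow> nat \<Rightarrow> real"
  note s = homeomorphic_maps_sphere_coords [where 'n = 'n]
  have c: "continuous_map ?S compactified f" "continuous_map compactified ?S g"
      "continuous_map ?S compactified ?f" "continuous_map compactified ?S ?g"
    using fg s by (auto simp: homeomorphic_maps_def)
  have inv: "f (g p) = p" "?f (?g p) = p" for p
    using fg s by (cases p; auto simp: homeomorphic_maps_def)+
  have inv': "?g (?f x) = x" "g (f x) = x" if "x \<in> topspace ?S" for x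
    using fg s that by (auto simp: homeomorphic_maps_def)
  have cc: "continuous_map ?S ?S (g \<circ> ?f)" "continuous_map ?S ?S (?g \<circ> f)"
      "continuous_map ?S ?S (?g \<circ> F \<circ> ?f)"
    using c F by (meson continuous_map_compose)+
  have "?D (g \<circ> F \<circ> f) = ?D ((g \<circ> ?f) \<circ> (?g \<circ> F \<circ> ?f) \<circ> (?g \<circ> f))"
    by (intro Brouwer_degree2_eq) (simp add: inv)
  also have "\<dots> = ?D (g \<circ> ?f) * ?D (?g \<circ> F \<circ> ?f) * ?D (?g \<circ> f)"
    using cc by (simp add: Brouwer_degree2_compose continuous_map_compose)
  also have "\<dots> = ?D ((g \<circ> ?f) \<circ> (?g \<circ> f)) * ?D (?g \<circ> F \<circ> ?f)"
    using cc by (simp add: Brouwer_degree2_compose)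
  also have "?D ((g \<circ> ?f) \<circ> (?g \<circ> f)) = ?D id"
    by (intro Brouwer_degree2_eq) (simp add: inv inv')
  finally show ?thesis
    by (simp add: compactification_degree_def comp_def)
qed

lemma compactification_degree_homotopic:
  fixes F G :: "(real ^ 'n) option \<Rightarrow> (real ^ 'n) option"
  assumes "homotopic_with (\<lambda>_. True) compactified compactified F G"
  shows "compactification_degree F = compactification_degree G"
proof -
  let ?S = "nsphere CARD('n)"
  let ?f = "fst sphere_coords :: (nat \<Rightarrow> real) \<Rightarrow> (real ^ 'n) option"
  let ?g = "snd sphere_coords :: (real ^ 'n) option \<Rightarrow> nat \<Rightarrow> real"
  have c: "continuous_map ?S compactified ?f" "continuous_map compactified ?S ?g"
    using homeomorphic_maps_sphere_coords by (auto simp: homeomorphic_maps_def)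
  have "homotopic_with (\<lambda>_. True) ?S ?S (?g \<circ> F \<circ> ?f) (?g \<circ> G \<circ> ?f)"
    by (rule homotopic_with_compose_continuous_map_right
        [OF homotopic_with_compose_continuous_map_left [OF assms c(2)] c(1)]) auto
  then show ?thesis
    unfolding compactification_degree_def by (rule Brouwer_degree2_homotopic)
qed

lemma compactification_degree_id:
  "compactification_degree (id :: (real ^ 'n) option \<Rightarrow> (real ^ 'n) option) = 1"
proof -
  have "compactification_degree (id :: (real ^ 'n) option \<Rightarrow> (real ^ 'n) option) =
      Brouwer_degree2 CARD('n) id"
    unfolding compactification_degree_def
    using homeomorphic_maps_sphere_coords [where 'n = 'n]
    by (intro Brouwer_degree2_eq) (auto simp: homeomorphic_maps_def)
  then show ?thesis by simp
qed

lemma continuous_map_into_compactified: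
  fixes q :: "'a::metric_space \<times> (real ^ 'n) \<Rightarrow> real ^ 'n"
  assumes W: "openin (top_of_set (T \<times> UNIV)) W"
    and q: "continuous_on W q"
    and proper: "\<And>C. compact C \<Longrightarrow> compact {w \<in> W. q w \<in> C}"
  shows "continuous_map (prod_topology (top_of_set T) compactified) compactified
           (\<lambda>(t, p). case p of None \<Rightarrow> None | Some x \<Rightarrow> if (t, x) \<in> W then Some (q (t, x)) else None)"
    (is "continuous_map ?X _ ?F")
proof -
  define E :: "'a \<times> (real ^ 'n) \<Rightarrow> 'a \<times> (real ^ 'n) option" where "E = (\<lambda>(t, x). (t, Some x))"
  have WT: "W \<subseteq> T \<times> UNIV"
    using W openin_imp_subset by blast
  have prod_eq: "top_of_set (T \<times> (UNIV :: (real ^ 'n) set)) = prod_topology (top_of_set T) euclidean"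
    by (metis prod_topology_subtopology_eu subtopology_UNIV)
  have openE: "openin ?X (E ` V)" if "openin (top_of_set (T \<times> UNIV)) V" for V
    unfolding openin_prod_topology_alt
  proof (intro strip)
    fix t p
    assume "(t, p) \<in> E ` V"
    then obtain x where x: "p = Some x" "(t, x) \<in> V"
      by (auto simp: E_def)
    have "\<forall>a b. (a, b) \<in> V \<longrightarrow> (\<exists>M N. openin (top_of_set T) M \<and> openin euclidean N \<and>
        a \<in> M \<and> b \<in> N \<and> M \<times> N \<subseteq> V)"
      using that unfolding prod_eq openin_prod_topology_alt .
    from this [rule_format, OF x(2)]
    obtain M N where MN: "openin (top_of_set T) M" "openin euclidean N" "t \<in> M" "x \<in> N" "M \<times> N \<subseteq> V"
      by (elim exE conjE)
    have "openin compactified (Some ` N)"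
      using MN by simp
    moreover have "M \<times> Some ` N \<subseteq> E ` V"
      using MN by (force simp: E_def)
    ultimately show "\<exists>M N. openin (top_of_set T) M \<and> openin compactified N \<and> t \<in> M \<and> p \<in> N \<and> M \<times> N \<subseteq> E ` V"
      using MN x by blast
  qed
  have contE: "continuous_map (top_of_set (T \<times> UNIV)) ?X E"
    unfolding prod_eq E_def case_prod_unfold
    by (intro continuous_map_pairedI continuous_map_fst
        continuous_map_compose [OF continuous_map_snd continuous_map_Some, unfolded comp_def])
  have "Hausdorff_space (top_of_set T)"
    by (simp add: Hausdorff_space_subtopology)
  then have Haus: "Hausdorff_space ?X"
    by (simp add: Hausdorff_space_prod_topology
        Hausdorff_space_Alexandroff_compactification locally_compact_space_euclidean)
  show ?thesis
    unfolding continuous_map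
  proof (intro conjI strip)
    show "?F ` topspace ?X \<subseteq> topspace compactified"
      by (auto simp: notin_range_Some)
    fix V :: "(real ^ 'n) option set"
    assume "openin compactified V"
    then consider U where "open U" "V = Some ` U" | C where "compact C" "V = insert None (Some ` (- C))"
      by (auto simp: openin_Alexandroff_compactification Compl_eq_Diff_UNIV)
    then show "openin ?X {w \<in> topspace ?X. ?F w \<in> V}"
    proof cases
      case 1
      have "openin (top_of_set W) (W \<inter> q -` U)"
        using q 1 by (simp add: continuous_openin_preimage_gen)
      then have "openin (top_of_set (T \<times> UNIV)) (W \<inter> q -` U)"
        using W openin_trans by blast
      moreover have "{w \<in> topspace ?X. ?F w \<in> V} = E ` (W \<inter> q -` U)"
        using 1 WT by (auto simp: E_def image_iff split: option.splits if_splits)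
      ultimately show ?thesis
        using openE by metis
    next
      case 2
      let ?K = "{w \<in> W. q w \<in> C}"
      have "compactin (top_of_set (T \<times> UNIV)) ?K"
        using proper [OF 2(1)] WT by (auto simp: compactin_subtopology)
      then have "closedin ?X (E ` ?K)"
        using image_compactin [OF _ contE] Haus compactin_imp_closedin by blast
      moreover have "{w \<in> topspace ?X. ?F w \<in> V} = topspace ?X - E ` ?K"
        using 2 by (auto simp: E_def image_iff split: option.splits if_splits)
      ultimately show ?thesis
        by (simp only: openin_diff openin_topspace)
    qed
  qed
qed

lemma infdist_frontier_pos:
  fixes y :: "real ^ 'n \<Rightarrow> real ^ 'n"
  assumes "bounded A" "continuous_on (closure A) y" "z \<notin> y ` frontier A" "frontier A \<noteq> {}"
  shows "infdist z (y ` frontier A) > 0"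
proof -
  have "compact (frontier A)"
    using assms by (simp add: compact_frontier_bounded)
  moreover have "continuous_on (frontier A) y"
    using assms by (auto simp: frontier_def intro: continuous_on_subset)
  ultimately have "closed (y ` frontier A)"
    by (simp add: compact_continuous_image compact_imp_closed)
  then show ?thesis
    using assms by (simp add: infdist_pos_not_in_closed)
qed

lemma continuous_map_collapse:
  fixes y :: "real ^ 'n \<Rightarrow> real ^ 'n"
  assumes A: "open A" "bounded A" and y: "continuous_on (closure A) y" and z: "z \<notin> y ` frontier A"
  shows "continuous_map compactified compactified (collapse y A z)"
proof -
  define r where "r = infdist z (y ` frontier A)"
  define D where "D = {x \<in> A. dist (y x) z < r}"
  define q where "q = (\<lambda>(t::real, x). (y x - z) /\<^sub>R (r - dist (y x) z))"
  have yA: "continuous_on A y"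
    using y closure_subset continuous_on_subset by blast
  have "open D"
  proof -
    have "open (A \<inter> (\<lambda>x. dist (y x) z) -` {..<r})"
      by (intro continuous_open_preimage continuous_intros yA A)
    moreover have "D = A \<inter> (\<lambda>x. dist (y x) z) -` {..<r}"
      by (auto simp: D_def)
    ultimately show ?thesis by simp
  qed
  have yD: "continuous_on D y"
    using yA by (rule continuous_on_subset) (auto simp: D_def)
  have far: "r \<le> dist (y x) z" if "x \<in> frontier A" for x
    using that unfolding r_def by (metis dist_commute imageI infdist_le)
  have "continuous_map (prod_topology (top_of_set {0}) compactified) compactified
      (\<lambda>(t, p). case p of None \<Rightarrow> None
        | Some x \<Rightarrow> if (t, x) \<in> {0} \<times> D then Some (q (t, x)) else None)"
  proof (rule continuous_map_into_compactified)
    show "openin (top_of_set ({0} \<times> UNIV)) ({0::real} \<times> D)"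
      using \<open>open D\<close> by (intro openin_Times) auto
    have ys: "continuous_on ({0} \<times> D) (\<lambda>w::real \<times> (real ^ 'n). y (snd w))"
      by (rule continuous_on_compose2 [OF yD]) (auto intro: continuous_intros)
    have "continuous_on ({0} \<times> D) (\<lambda>w::real \<times> (real ^ 'n). r - dist (y (snd w)) z)"
      by (intro continuous_on_diff continuous_on_dist continuous_on_const ys)
    then have "continuous_on ({0} \<times> D) (\<lambda>w::real \<times> (real ^ 'n). inverse (r - dist (y (snd w)) z))"
      by (rule continuous_on_inverse) (auto simp: D_def)
    then show "continuous_on ({0} \<times> D) q"
      unfolding q_def case_prod_unfold
      by (intro continuous_on_scaleR continuous_on_diff continuous_on_const ys)
    fix C :: "(real ^ 'n) set"
    assume C: "compact C"
    obtain M where M: "M > 0" "\<And>c. c \<in> C \<Longrightarrow> norm c \<le> M"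
      using compact_imp_bounded [OF C] unfolding bounded_pos by auto
    have eq: "{w \<in> {0} \<times> D. q w \<in> C} = {0} \<times> {x \<in> D. q (0, x) \<in> C}"
      by auto
    define K where "K = {x \<in> closure A. dist (y x) z \<le> r - r / (1 + M)}"
    have "compact {x \<in> D. q (0, x) \<in> C}"
    proof (cases "D = {}")
      case False
      then have r: "r > 0"
        unfolding D_def using zero_le_dist by (metis (lifting) Collect_empty_eq order_le_less_trans)
      have "closed (closure A \<inter> (\<lambda>x. dist (y x) z) -` {..r - r / (1 + M)})"
        by (intro continuous_closed_preimage continuous_intros y) auto
      moreover have "K = closure A \<inter> (\<lambda>x. dist (y x) z) -` {..r - r / (1 + M)}"
        by (auto simp: K_def)
      ultimately have "compact K"
        using A by (metis Int_lower1 bounded_closure bounded_subset compact_eq_bounded_closed)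
      have pos: "r / (1 + M) > 0"
        using r M by simp
      have "K \<subseteq> D"
      proof
        fix x assume x: "x \<in> K"
        then have "dist (y x) z < r"
          using pos by (simp add: K_def)
        then have "x \<notin> frontier A"
          using far [of x] by auto
        then show "x \<in> D"
          using x A \<open>dist (y x) z < r\<close> by (auto simp: K_def D_def frontier_def interior_open)
      qed
      have "{x \<in> D. q (0, x) \<in> C} = K \<inter> (\<lambda>x. q (0, x)) -` C"
      proof -
        have "x \<in> K" if x: "x \<in> D" "q (0, x) \<in> C" for x
        proof -
          let ?e = "dist (y x) z"
          have e: "?e < r" using x by (simp add: D_def)
          have "?e / (r - ?e) \<le> M"
            using M(2) [OF x(2)] e by (simp add: q_def dist_norm divide_inverse mult.commute)
          then have "?e \<le> M * (r - ?e)"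
            using e by (simp add: pos_divide_le_eq)
          then have "r \<le> (r - ?e) * (1 + M)"
            by (simp add: algebra_simps)
          then have "r / (1 + M) \<le> r - ?e"
            using M by (simp add: pos_divide_le_eq)
          then show ?thesis
            using x closure_subset by (auto simp: K_def D_def)
        qed
        then show ?thesis
          using \<open>K \<subseteq> D\<close> by auto
      qed
      moreover have cK: "continuous_on K (\<lambda>x. q (0, x))"
      proof -
        have yK: "continuous_on K y"
          using yD \<open>K \<subseteq> D\<close> continuous_on_subset by blast
        have "continuous_on K (\<lambda>x. r - dist (y x) z)"
          by (intro continuous_on_diff continuous_on_dist continuous_on_const yK)
        then have "continuous_on K (\<lambda>x. inverse (r - dist (y x) z))"
          using \<open>K \<subseteq> D\<close> by (intro continuous_on_inverse) (auto simp: D_def)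
        then show ?thesis
          unfolding q_def prod.case
          by (intro continuous_on_scaleR continuous_on_diff continuous_on_const yK)
      qed
      moreover have "closed (K \<inter> (\<lambda>x. q (0, x)) -` C)"
        by (rule continuous_closed_preimage [OF cK compact_imp_closed [OF \<open>compact K\<close>] compact_imp_closed [OF C]])
      moreover have "bounded (K \<inter> (\<lambda>x. q (0, x)) -` C)"
        using compact_imp_bounded [OF \<open>compact K\<close>] by (rule bounded_subset) auto
      ultimately show ?thesis
        by (simp add: compact_eq_bounded_closed)
    qed simp
    then show "compact {w \<in> {0::real} \<times> D. q w \<in> C}"
      unfolding eq by (rule compact_Times [OF compact_sing])
  qed
  then have "continuous_map compactified compactified
      ((\<lambda>(t, p). case p of None \<Rightarrow> None
        | Some x \<Rightarrow> if (t, x) \<in> {0::real} \<times> D then Some (q (t, x)) else None) \<circ> (\<lambda>p. (0, p)))"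
    by (rule continuous_map_compose [rotated])
      (intro continuous_map_pairedI continuous_map_id [unfolded id_def], simp)
  moreover have "collapse y A z = (\<lambda>(t, p). case p of None \<Rightarrow> None
        | Some x \<Rightarrow> if (t, x) \<in> {0::real} \<times> D then Some (q (t, x)) else None) \<circ> (\<lambda>p. (0, p))"
  proof
    fix p
    show "collapse y A z p = ((\<lambda>(t, p). case p of None \<Rightarrow> None
        | Some x \<Rightarrow> if (t, x) \<in> {0::real} \<times> D then Some (q (t, x)) else None) \<circ> (\<lambda>p. (0, p))) p"
      by (cases p) (simp_all add: collapse_def Let_def D_def q_def flip: r_def)
  qed
  ultimately show ?thesis
    by simp
qed

lemma degree_on_id:
  fixes z :: "real ^ 'n"
  assumes A: "open A" "bounded A" and z: "z \<in> A"
  shows "degree_on (\<lambda>x. x) A z = 1"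
proof -
  define r where "r = infdist z (frontier A)"
  have zf: "z \<notin> frontier A"
    using A z by (simp add: frontier_def interior_open)
  have "frontier A \<noteq> {}"
    using A z by (metis empty_iff frontier_eq_empty not_bounded_UNIV)
  then have r: "r > 0"
    unfolding r_def using zf by (simp add: infdist_pos_not_in_closed)
  have "ball z r \<inter> frontier A = {}"
    using infdist_le [of _ "frontier A" z] by (force simp: r_def)
  then have ball: "ball z r \<subseteq> A"
    using connected_Int_frontier [of "ball z r" A] z r by (metis Diff_eq_empty_iff IntI centre_in_ball connected_ball empty_iff)
  define \<phi> where "\<phi> = (\<lambda>(t, x). (1 - t) * (r - dist x z) + t)"
  define q where "q = (\<lambda>(t, x). t *\<^sub>R z + (x - z) /\<^sub>R \<phi> (t, x))"
  define W where "W = {w \<in> {0..1} \<times> UNIV. \<phi> w > 0}"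
  define H where "H = (\<lambda>(t::real, p). case p of None \<Rightarrow> None
      | Some x \<Rightarrow> if (t, x) \<in> W then Some (q (t, x)) else None)"
  have cont\<phi>: "continuous_on S \<phi>" for S
    unfolding \<phi>_def case_prod_unfold by (intro continuous_intros)
  have contq: "continuous_on S q" if "\<And>w. w \<in> S \<Longrightarrow> \<phi> w \<noteq> 0" for S
  proof -
    have "continuous_on S (\<lambda>w. fst w *\<^sub>R z + (snd w - z) /\<^sub>R \<phi> w)"
      using that by (intro continuous_intros cont\<phi>) auto
    then show ?thesis
      by (simp add: q_def case_prod_unfold)
  qed
  have "continuous_map (prod_topology (top_of_set {0..1}) compactified) compactified H"
    unfolding H_def
  proof (rule continuous_map_into_compactified)
    have "W = ({0..1} \<times> UNIV) \<inter> \<phi> -` {0<..}"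
      by (auto simp: W_def)
    then show "openin (top_of_set ({0..1} \<times> UNIV)) W"
      using continuous_openin_preimage_gen [OF cont\<phi>, of "{0<..}" "{0..1} \<times> UNIV"] by simp
    show "continuous_on W q"
      by (rule contq) (auto simp: W_def)
    fix C :: "(real ^ 'n) set"
    assume C: "compact C"
    obtain M where M: "M > 0" "\<And>c. c \<in> C \<Longrightarrow> norm c \<le> M"
      using compact_imp_bounded [OF C] unfolding bounded_pos by auto
    define N where "N = M + norm z"
    have N: "N > 0"
      using M by (simp add: N_def add_pos_nonneg)
    define \<delta> where "\<delta> = min r 1 / (1 + N)"
    have \<delta>: "\<delta> > 0"
      using r N by (simp add: \<delta>_def)
    define K where "K = ({0..1} \<times> cball z (N * (r + 1))) \<inter> \<phi> -` {\<delta>..}"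
    have "closed K"
      unfolding K_def by (intro continuous_closed_preimage cont\<phi> closed_Times) auto
    then have "compact K"
      unfolding K_def by (metis Int_lower1 bounded_subset compact_Times compact_Icc compact_cball
          compact_eq_bounded_closed)
    have KW: "K \<subseteq> W"
      using \<delta> by (auto simp: K_def W_def)
    have "(t, x) \<in> K" if x: "(t, x) \<in> W" "q (t, x) \<in> C" for t x
    proof -
      have t: "0 \<le> t" "t \<le> 1" and pos: "\<phi> (t, x) > 0"
        using x by (auto simp: W_def)
      have "norm ((x - z) /\<^sub>R \<phi> (t, x)) \<le> norm (q (t, x)) + norm (t *\<^sub>R z)"
        unfolding q_def prod.case by (metis add_diff_cancel_left' norm_triangle_ineq4)
      also have "\<dots> \<le> N"
        using M(2) [OF x(2)] t unfolding N_def
        by (intro add_mono) (auto simp: mult_left_le_one_le)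
      finally have "dist x z / \<phi> (t, x) \<le> N"
        using pos by (simp add: dist_norm divide_inverse mult.commute)
      then have d: "dist x z \<le> N * \<phi> (t, x)"
        using pos by (simp add: pos_divide_le_eq)
      have "\<phi> (t, x) \<le> (1 - t) * r + t"
        unfolding \<phi>_def prod.case using t by (intro add_mono mult_left_mono) auto
      also have "\<dots> \<le> 1 * r + 1"
        using t r by (intro add_mono mult_right_mono) auto
      finally have "dist x z \<le> N * (r + 1)"
        using d N by (smt (verit) mult_left_mono)
      moreover have "\<phi> (t, x) \<ge> \<delta>"
      proof -
        have "min r 1 = (1 - t) * min r 1 + t * min r 1"
          by (simp add: algebra_simps)
        also have "\<dots> \<le> (1 - t) * r + t * 1"
          using t by (intro add_mono mult_left_mono) auto
        also have "\<dots> = \<phi> (t, x) + (1 - t) * dist x z"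
          by (simp add: \<phi>_def algebra_simps)
        also have "\<dots> \<le> \<phi> (t, x) + 1 * (N * \<phi> (t, x))"
          using t d by (intro add_mono mult_mono) auto
        also have "\<dots> = \<phi> (t, x) * (1 + N)"
          by (simp add: algebra_simps)
        finally show ?thesis
          unfolding \<delta>_def using N by (simp add: pos_divide_le_eq)
      qed
      ultimately show ?thesis
        using t by (simp add: K_def dist_commute)
    qed
    then have "{w \<in> W. q w \<in> C} = K \<inter> q -` C"
      using KW by auto
    moreover have "closed (K \<inter> q -` C)"
      using \<open>closed K\<close> C KW
      by (intro continuous_closed_preimage contq) (auto simp: W_def compact_imp_closed)
    ultimately show "compact {w \<in> W. q w \<in> C}"
      using \<open>compact K\<close> by (metis Int_lower1 bounded_subset compact_eq_bounded_closed)
  qed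
  moreover have "H (0, p) = collapse (\<lambda>x. x) A z p" for p
    using ball r by (auto simp: H_def collapse_def W_def q_def \<phi>_def Let_def dist_commute subset_iff
        simp flip: r_def split: option.splits)
  moreover have "H (1, p) = id p" for p
    by (auto simp: H_def W_def q_def \<phi>_def split: option.splits)
  ultimately have "homotopic_with (\<lambda>_. True) compactified compactified (collapse (\<lambda>x. x) A z) id"
    unfolding homotopic_with_def by blast
  then show ?thesis
    unfolding degree_on_def by (simp add: compactification_degree_homotopic compactification_degree_id)
qed


section \<open>Orientation preserving maps and images\<close>

definition compactly_inside :: "(real ^ 'n) set \<Rightarrow> (real ^ 'n) set set" where
  "compactly_inside \<Omega> = {A. open A \<and> compact (closure A) \<and> closure A \<subseteq> \<Omega>}"

definition nondegenerate_on :: "(real ^ 'n) set \<Rightarrow> (real ^ 'n \<Rightarrow> real ^ 'n) \<Rightarrow> bool" where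
  "nondegenerate_on \<Omega> y \<longleftrightarrow>
     (\<forall>V \<in> compactly_inside \<Omega>. V \<noteq> {} \<longrightarrow>
        (\<exists>A \<in> compactly_inside \<Omega>. A \<subseteq> V \<and> (\<exists>z. z \<notin> y ` frontier A \<and> degree_on y A z \<noteq> 0)))"

definition orientation_preserving_on :: "(real ^ 'n) set \<Rightarrow> (real ^ 'n \<Rightarrow> real ^ 'n) \<Rightarrow> bool" where
  "orientation_preserving_on \<Omega> y \<longleftrightarrow>
     (\<forall>A \<in> compactly_inside \<Omega>. \<forall>z. z \<notin> y ` frontier A \<longrightarrow> degree_on y A z \<ge> 0)"

definition strictly_orientation_preserving_on ::
    "(real ^ 'n) set \<Rightarrow> (real ^ 'n \<Rightarrow> real ^ 'n) \<Rightarrow> bool" where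
  "strictly_orientation_preserving_on \<Omega> y \<longleftrightarrow>
     nondegenerate_on \<Omega> y \<and> orientation_preserving_on \<Omega> y"

definition im_T :: "(real ^ 'n \<Rightarrow> real ^ 'n) \<Rightarrow> (real ^ 'n) set \<Rightarrow> (real ^ 'n) set" where
  "im_T y A = {z. z \<notin> y ` frontier A \<and> degree_on y A z \<noteq> 0}"

definition im_loc ::
    "(real ^ 'n) set \<Rightarrow> (real ^ 'n \<Rightarrow> real ^ 'n) \<Rightarrow> (real ^ 'n) set \<Rightarrow> (real ^ 'n) set" where
  "im_loc \<Omega> y U = (\<Union>A \<in> {A \<in> compactly_inside \<Omega>. A \<subseteq> U}. im_T y A)"

definition reduced_domain ::
    "(real ^ 'n) set \<Rightarrow> (real ^ 'n \<Rightarrow> real ^ 'n) \<Rightarrow> (real ^ 'n) set \<Rightarrow> (real ^ 'n) set" where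
  "reduced_domain \<Omega> y U =
     {x \<in> U. \<exists>A \<in> compactly_inside \<Omega>. x \<in> A \<and> A \<subseteq> U \<and> y x \<notin> y ` frontier A}"

end

theory Submission
  imports Defs
begin

text \<open>
  Three properties of the degree carry the argument: \<open>deg(y; A; \<cdot>)\<close> is locally constant
  (\<open>degree_on_locally_constant\<close>), it vanishes off the image \<open>y(closure A)\<close> (\<open>degree_on_eq_0\<close>), and it
  is additive: \<open>deg(y; A; z) = deg(y; A1; z) + deg(y; A2; z)\<close> for disjoint open \<open>A1, A2 \<subseteq> A\<close>
  that contain all preimages of \<open>z\<close> in the closure of \<open>A\<close> (\<open>degree_on_additive\<close>).  Local constancy
  is homotopy invariance.  Additivity rests on homology: a self-map of the sphere that is constant
  outside two separated sets induces on the top homology group the sum of the maps induced by its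
  two halves (\<open>hom_induced_additive\<close>).

  For an orientation preserving map additivity makes the degree monotone in the set, and even
  superadditive on disjoint sets (\<open>degree_on_superadditive\<close>).  With nondegeneracy, every
  set \<open>A\<close> has degree at least \<open>1\<close> at every value \<open>y x\<close>, \<open>x \<in> A\<close>, that lies off the image of its
  boundary (\<open>degree_on_pos\<close>): arbitrarily close to \<open>x\<close> there is a small set of positive degree.
  If the degree of \<open>U\<close> is at most \<open>1\<close>, two disjoint subsets of \<open>U\<close> can therefore never both have
  positive degree at the same value.  This bounds the degree on subsets of \<open>U\<close>, makes the fibres
  connected (\<open>fibre_connected\<close>), and keeps the image of the boundary away from the local image
  (\<open>im_loc_disjoint_image_frontier\<close>).  When the image of the boundary has empty interior, any value can be
  perturbed off it without changing the degrees of the finitely many sets involved.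
\<close>

section \<open>Additivity in homology\<close>

lemma hom_induced_into_subspace_trivial:
  assumes f: "continuous_map X Y f" and fT: "f \<in> topspace X \<rightarrow> T" and S: "S \<subseteq> topspace X"
  shows "hom_induced p X S Y T f c = \<one>\<^bsub>relative_homology_group p Y T\<^esub>"
proof -
  have "hom_induced p X S X (topspace X) id c = \<one>\<^bsub>relative_homology_group p X (topspace X)\<^esub>"
    using trivial_relative_homology_group_topspace [of p X] hom_induced_carrier [of p X S X "topspace X" id c]
    by (auto simp: trivial_group_def)
  moreover have "hom_induced p X S Y T f c
      = hom_induced p X (topspace X) Y T f (hom_induced p X S X (topspace X) id c)"
    using hom_induced_compose' [OF continuous_map_id _ f fT, of S p c] S by (simp add: subset_iff)
  ultimately show ?thesis
    by (simp add: hom_one [OF hom_induced_hom])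
qed

text \<open>
  One half of the relative Mayer--Vietoris sequence.  The class of \<open>a\<close> in \<open>H(X, B)\<close> comes from
  \<open>H(A, A \<inter> B)\<close> by excision; the difference dies in \<open>H(X, B)\<close>, so by the exact sequence of the
  triple \<open>(X, B, A \<inter> B)\<close> it comes from \<open>H(B, A \<inter> B)\<close>.
\<close>

lemma relative_homology_decomposition:
  assumes A: "A \<subseteq> topspace X" and AB: "X closure_of (topspace X - A) \<subseteq> X interior_of B"
    and a: "a \<in> carrier (relative_homology_group p X (A \<inter> B))"
  obtains b c where "b \<in> carrier (relative_homology_group p (subtopology X A) (A \<inter> B))"
    and "c \<in> carrier (relative_homology_group p (subtopology X B) (A \<inter> B))"
    and "a = hom_induced p (subtopology X A) (A \<inter> B) X (A \<inter> B) id b \<otimes>\<^bsub>relative_homology_group p X (A \<inter> B)\<^esub>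
             hom_induced p (subtopology X B) (A \<inter> B) X (A \<inter> B) id c"
proof -
  let ?G = "relative_homology_group p X (A \<inter> B)"
  let ?q = "hom_induced p X (A \<inter> B) X B id"
  let ?i = "hom_induced p (subtopology X A) (A \<inter> B) X (A \<inter> B) id"
  interpret G: comm_group ?G
    by simp
  interpret q: group_hom ?G "relative_homology_group p X B" ?q
    by (simp add: group_hom_def group_hom_axioms_def hom_induced_hom)
  have "?q a \<in> carrier (relative_homology_group p X (B \<inter> topspace X))"
    by (metis Int_commute hom_induced_carrier relative_homology_group_restrict)
  moreover have "hom_induced p (subtopology X (topspace X - (topspace X - A)))
      (B \<inter> topspace X - (topspace X - A)) (subtopology X (topspace X)) (B \<inter> topspace X) id
    \<in> iso (relative_homology_group p (subtopology X (topspace X - (topspace X - A))) (B \<inter> topspace X - (topspace X - A)))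
          (relative_homology_group p (subtopology X (topspace X)) (B \<inter> topspace X))"
  proof (rule homology_excision_axiom)
    show "X closure_of (topspace X - A) \<subseteq> X interior_of (B \<inter> topspace X)"
      using AB by (metis Int_commute interior_of_restrict)
  qed auto
  moreover have "topspace X - (topspace X - A) = A" "B \<inter> topspace X - (topspace X - A) = A \<inter> B"
    using A by auto
  ultimately obtain b where b: "b \<in> carrier (relative_homology_group p (subtopology X A) (A \<inter> B))"
    and qb: "?q a = hom_induced p (subtopology X A) (A \<inter> B) X (B \<inter> topspace X) id b"
    unfolding iso_def bij_betw_def by simp (metis (no_types, lifting) imageE)
  have qi: "?q (?i b) = ?q a"
  proof -
    have "?q (?i b) = hom_induced p (subtopology X A) (A \<inter> B) X B id b"
      using hom_induced_compose' [of "subtopology X A" X id "A \<inter> B" "A \<inter> B" X id B p b]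
      by (auto simp: continuous_map_from_subtopology)
    also have "\<dots> = ?q a"
      unfolding qb by (metis hom_induced_restrict Int_commute Int_left_commute Int_absorb)
    finally show ?thesis .
  qed
  define d where "d = a \<otimes>\<^bsub>?G\<^esub> inv\<^bsub>?G\<^esub> ?i b"
  have ib: "?i b \<in> carrier ?G"
    by (simp add: hom_induced_carrier)
  have d: "d \<in> carrier ?G"
    unfolding d_def using a ib by simp
  have "?q d = \<one>\<^bsub>relative_homology_group p X B\<^esub>"
    unfolding d_def using a ib qi by simp
  then have "d \<in> kernel ?G (relative_homology_group p X B) ?q"
    using d by (simp add: kernel_def)
  moreover have "A \<inter> B \<subseteq> B" by auto
  ultimately have "d \<in> hom_induced p (subtopology X B) (A \<inter> B) X (A \<inter> B) id `
      carrier (relative_homology_group p (subtopology X B) (A \<inter> B))"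
    using homology_exactness_triple_3 [of "A \<inter> B" B p X] by simp
  then obtain c where c: "c \<in> carrier (relative_homology_group p (subtopology X B) (A \<inter> B))"
    and dc: "d = hom_induced p (subtopology X B) (A \<inter> B) X (A \<inter> B) id c"
    by auto
  have "a = ?i b \<otimes>\<^bsub>?G\<^esub> d"
    unfolding d_def using a ib by (simp add: G.m_lcomm)
  with b c dc that show ?thesis by metis
qed

text \<open>
  The maps \<open>f1\<close> and \<open>f2\<close> are the two halves of \<open>f\<close>: the map \<open>f1\<close> agrees with \<open>f\<close> on \<open>A\<close> and is
  constant on \<open>B\<close>, and \<open>f2\<close> the other way round.
\<close>

lemma hom_induced_additive:
  assumes f: "continuous_map X Y f" "continuous_map X Y f1" "continuous_map X Y f2"
    and A: "A \<subseteq> topspace X" and B: "B \<subseteq> topspace X"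
    and AB: "X closure_of (topspace X - A) \<subseteq> X interior_of B"
    and onA: "\<And>x. x \<in> A \<Longrightarrow> f x = f1 x" "\<And>x. x \<in> A \<Longrightarrow> f2 x = e"
    and onB: "\<And>x. x \<in> B \<Longrightarrow> f x = f2 x" "\<And>x. x \<in> B \<Longrightarrow> f1 x = e"
  shows "hom_induced p X {} Y {e} f a =
         hom_induced p X {} Y {e} f1 a \<otimes>\<^bsub>relative_homology_group p Y {e}\<^esub> hom_induced p X {} Y {e} f2 a"
proof (cases "a \<in> carrier (homology_group p X)")
  case True
  let ?G = "relative_homology_group p X (A \<inter> B)"
  let ?H = "relative_homology_group p Y {e}"
  let ?h = "hom_induced p X (A \<inter> B) Y {e}"
  interpret H: comm_group ?H
    by simp
  have fe: "f \<in> A \<inter> B \<rightarrow> {e}" "f1 \<in> A \<inter> B \<rightarrow> {e}" "f2 \<in> A \<inter> B \<rightarrow> {e}"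
    using onA onB by auto
  let ?a = "hom_induced p X {} X (A \<inter> B) id a"
  have rel: "hom_induced p X {} Y {e} g a = ?h g ?a"
    if "continuous_map X Y g" "g \<in> A \<inter> B \<rightarrow> {e}" for g
    using that hom_induced_compose' [of X X id "{}" "A \<inter> B" Y g "{e}" p a] by auto
  have "?a \<in> carrier ?G"
    by (simp add: hom_induced_carrier)
  then obtain b c where "b \<in> carrier (relative_homology_group p (subtopology X A) (A \<inter> B))"
    and "c \<in> carrier (relative_homology_group p (subtopology X B) (A \<inter> B))"
    and a: "?a = hom_induced p (subtopology X A) (A \<inter> B) X (A \<inter> B) id b \<otimes>\<^bsub>?G\<^esub>
             hom_induced p (subtopology X B) (A \<inter> B) X (A \<inter> B) id c"
    using relative_homology_decomposition [OF A AB] by metis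
  let ?hA = "\<lambda>g. hom_induced p (subtopology X A) (A \<inter> B) Y {e} g b"
  let ?hB = "\<lambda>g. hom_induced p (subtopology X B) (A \<inter> B) Y {e} g c"
  have split: "?h g ?a = ?hA g \<otimes>\<^bsub>?H\<^esub> ?hB g"
    if g: "continuous_map X Y g" "g \<in> A \<inter> B \<rightarrow> {e}" for g
  proof -
    have "?h g (hom_induced p (subtopology X A) (A \<inter> B) X (A \<inter> B) id b) = ?hA g"
      using g hom_induced_compose' [of "subtopology X A" X id "A \<inter> B" "A \<inter> B" Y g "{e}" p b]
      by (auto simp: continuous_map_from_subtopology)
    moreover have "?h g (hom_induced p (subtopology X B) (A \<inter> B) X (A \<inter> B) id c) = ?hB g"
      using g hom_induced_compose' [of "subtopology X B" X id "A \<inter> B" "A \<inter> B" Y g "{e}" p c]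
      by (auto simp: continuous_map_from_subtopology)
    ultimately show ?thesis
      unfolding a by (simp add: hom_mult [OF hom_induced_hom] hom_induced_carrier)
  qed
  have car: "?hA g \<in> carrier ?H" "?hB g \<in> carrier ?H" for g
    by (simp_all add: hom_induced_carrier)
  have "?hA f = ?hA f1"
    using hom_induced_eq [of "subtopology X A" f f1 p "A \<inter> B" Y "{e}"] onA by simp
  moreover have "?hB f = ?hB f2"
    using hom_induced_eq [of "subtopology X B" f f2 p "A \<inter> B" Y "{e}"] onB by simp
  moreover have "?hA f2 = \<one>\<^bsub>?H\<^esub>"
    using onA f A by (intro hom_induced_into_subspace_trivial) (auto intro: continuous_map_from_subtopology)
  moreover have "?hB f1 = \<one>\<^bsub>?H\<^esub>"
    using onB f B by (intro hom_induced_into_subspace_trivial) (auto intro: continuous_map_from_subtopology)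
  ultimately show ?thesis
    using car [of f1] car [of f2] by (simp add: rel split f fe del: one_relative_homology_group)
next
  case False
  interpret H: comm_group "relative_homology_group p Y {e}"
    by simp
  show ?thesis
    using False hom_induced_default by (metis H.one_closed H.r_one)
qed

lemma Brouwer_degree2_additive:
  assumes f: "continuous_map (nsphere p) (nsphere p) f" "continuous_map (nsphere p) (nsphere p) f1"
      "continuous_map (nsphere p) (nsphere p) f2"
    and A: "A \<subseteq> topspace (nsphere p)" and B: "B \<subseteq> topspace (nsphere p)"
    and AB: "nsphere p closure_of (topspace (nsphere p) - A) \<subseteq> nsphere p interior_of B"
    and onA: "\<And>x. x \<in> A \<Longrightarrow> f x = f1 x" "\<And>x. x \<in> A \<Longrightarrow> f2 x = e"
    and onB: "\<And>x. x \<in> B \<Longrightarrow> f x = f2 x" "\<And>x. x \<in> B \<Longrightarrow> f1 x = e"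
    and e: "e \<in> topspace (nsphere p)"
  shows "Brouwer_degree2 p f = Brouwer_degree2 p f1 + Brouwer_degree2 p f2"
proof (rule Brouwer_degree2_unique [OF f(1)])
  let ?X = "nsphere p"
  let ?R = "reduced_homology_group p ?X"
  let ?H = "relative_homology_group p ?X {e}"
  let ?j = "hom_induced p ?X {} ?X {e} id"
  fix x assume x: "x \<in> carrier ?R"
  interpret R: group ?R by simp
  interpret H: group ?H by simp
  have iso: "?j \<in> iso ?R ?H"
    using e by (intro iso_reduced_homology_by_contractible contractible_space_subtopology_singleton) auto
  then have inj: "inj_on ?j (carrier ?R)" and hom: "?j \<in> hom ?R ?H"
    by (auto simp: iso_def bij_betw_def)
  have j: "?j (hom_induced p ?X {} ?X {} g x) = hom_induced p ?X {} ?X {e} g x"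
    if "continuous_map ?X ?X g" for g
    using that hom_induced_compose' [of ?X ?X g "{}" "{}" ?X id "{e}" p x] by auto
  have red: "hom_induced p ?X {} ?X {} g x \<in> carrier ?R" for g
    using hom_induced_reduced x by blast
  have "?j (hom_induced p ?X {} ?X {} f x) =
      ?j (hom_induced p ?X {} ?X {} f1 x \<otimes>\<^bsub>?R\<^esub> hom_induced p ?X {} ?X {} f2 x)"
    using hom_induced_additive [OF f A B AB onA onB, where p = p and a = x]
    by (simp add: hom_mult [OF hom] red j f)
  then have "hom_induced p ?X {} ?X {} f x = hom_induced p ?X {} ?X {} f1 x \<otimes>\<^bsub>?R\<^esub> hom_induced p ?X {} ?X {} f2 x"
    using inj red by (meson R.m_closed inj_onD)
  then show "hom_induced p ?X {} ?X {} f x = x [^]\<^bsub>?R\<^esub> (Brouwer_degree2 p f1 + Brouwer_degree2 p f2)"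
    by (simp add: Brouwer_degree2 [OF x] R.int_pow_mult x)
qed

section \<open>Homotopies and additivity of the degree on bounded open sets\<close>

text \<open>
  Additivity of the degree for a map that sends everything outside \<open>D1 \<union> D2\<close> to infinity.  The sets
  \<open>A\<close> and \<open>B\<close> of the homological statement are the complements of \<open>D2\<close> and \<open>D1\<close>; the disjointness of
  the closures gives the room needed for excision.
\<close>

lemma compactification_degree_additive:
  fixes F F1 F2 :: "(real ^ 'n) option \<Rightarrow> (real ^ 'n) option"
  assumes F: "continuous_map compactified compactified F" "continuous_map compactified compactified F1"
      "continuous_map compactified compactified F2"
    and D: "bounded D1" "bounded D2" "closure D1 \<inter> closure D2 = {}"
    and off2: "\<And>p. p \<notin> Some ` D2 \<Longrightarrow> F p = F1 p" "\<And>p. p \<notin> Some ` D2 \<Longrightarrow> F2 p = None"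
    and off1: "\<And>p. p \<notin> Some ` D1 \<Longrightarrow> F p = F2 p" "\<And>p. p \<notin> Some ` D1 \<Longrightarrow> F1 p = None"
  shows "compactification_degree F = compactification_degree F1 + compactification_degree F2"
proof -
  let ?X = "nsphere CARD('n)"
  let ?f = "fst sphere_coords :: (nat \<Rightarrow> real) \<Rightarrow> (real ^ 'n) option"
  let ?g = "snd sphere_coords :: (real ^ 'n) option \<Rightarrow> nat \<Rightarrow> real"
  have c: "continuous_map ?X compactified ?f" "continuous_map compactified ?X ?g"
    using homeomorphic_maps_sphere_coords by (auto simp: homeomorphic_maps_def)
  define A where "A = {x \<in> topspace ?X. ?f x \<notin> Some ` D2}"
  define B where "B = {x \<in> topspace ?X. ?f x \<notin> Some ` D1}"
  have closed: "closedin ?X {x \<in> topspace ?X. ?f x \<in> Some ` closure D}" if "bounded D" for D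
  proof -
    have "compactin compactified (Some ` closure D)"
      using that by (intro image_compactin [OF _ continuous_map_Some]) simp
    moreover have "Hausdorff_space (compactified :: (real ^ 'n) option topology)"
      by (simp add: Hausdorff_space_Alexandroff_compactification locally_compact_space_euclidean)
    ultimately show ?thesis
      using c(1) compactin_imp_closedin closedin_continuous_map_preimage by blast
  qed
  have "?X closure_of (topspace ?X - A) \<subseteq> {x \<in> topspace ?X. ?f x \<in> Some ` closure D2}"
    using closure_subset [of D2] by (intro closure_of_minimal closed D) (auto simp: A_def)
  also have "\<dots> \<subseteq> topspace ?X - {x \<in> topspace ?X. ?f x \<in> Some ` closure D1}"
    using D by auto
  also have "\<dots> \<subseteq> ?X interior_of B"
    using closure_subset [of D1]
    by (intro interior_of_maximal openin_diff openin_topspace closed D) (auto simp: B_def)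
  finally have AB: "?X closure_of (topspace ?X - A) \<subseteq> ?X interior_of B" .
  show ?thesis
    unfolding compactification_degree_def
  proof (rule Brouwer_degree2_additive [where A = A and B = B and e = "?g None"])
    show "?g None \<in> topspace ?X"
      using c(2) by (auto simp: continuous_map_def)
  qed (use AB off1 off2 c F in \<open>auto simp: A_def B_def intro: continuous_map_compose\<close>)
qed

lemma degree_on_eq_0:
  fixes y :: "real ^ 'n \<Rightarrow> real ^ 'n"
  assumes "open A" "bounded A" "continuous_on (closure A) y" "z \<notin> y ` closure A"
  shows "degree_on y A z = 0"
proof -
  let ?X = "nsphere CARD('n)"
  let ?f = "fst sphere_coords :: (nat \<Rightarrow> real) \<Rightarrow> (real ^ 'n) option"
  let ?g = "snd sphere_coords :: (real ^ 'n) option \<Rightarrow> nat \<Rightarrow> real"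
  have c: "continuous_map ?X compactified ?f" "continuous_map compactified ?X ?g"
      and inv: "?f (?g p) = p" for p
    using homeomorphic_maps_sphere_coords [where 'n = 'n] by (cases p; auto simp: homeomorphic_maps_def)+
  have z: "z \<notin> y ` A" "z \<notin> y ` frontier A"
    using assms closure_subset by (auto simp: frontier_def)
  have F: "continuous_map compactified compactified (collapse y A z)"
    using assms z by (intro continuous_map_collapse)
  have "collapse y A z p \<noteq> Some 0" for p
    using z by (cases p) (auto simp: collapse_def Let_def)
  then have "?g (Some 0) \<notin> (?g \<circ> collapse y A z \<circ> ?f) ` topspace ?X"
    using inv by (auto simp: image_iff) metis
  moreover have "?g (Some 0) \<in> topspace ?X"
    using c(2) by (auto simp: continuous_map_def)
  moreover have "continuous_map ?X ?X (?g \<circ> collapse y A z \<circ> ?f)"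
    using c F by (meson continuous_map_compose)
  ultimately show ?thesis
    unfolding degree_on_def compactification_degree_def
    by (intro Brouwer_degree2_nonsurjective) auto
qed

text \<open>
  The collapse of \<open>y\<close> around \<open>z\<close> with a free radius \<open>\<rho>\<close> in place of the distance from \<open>z\<close> to the
  image of the boundary; the radius and \<open>z\<close> may then be varied in a homotopy.
\<close>

definition collapse_radius ::
    "(real ^ 'n \<Rightarrow> real ^ 'n) \<Rightarrow> (real ^ 'n) set \<Rightarrow> real ^ 'n \<Rightarrow> real \<Rightarrow> (real ^ 'n) option \<Rightarrow> (real ^ 'n) option" where
  "collapse_radius y A z \<rho> p =
     (case p of
        None \<Rightarrow> None
      | Some x \<Rightarrow>
          if x \<in> A \<and> dist (y x) z < \<rho> then Some ((y x - z) /\<^sub>R (\<rho> - dist (y x) z)) else None)"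

lemma collapse_eq_collapse_radius:
  "collapse y A z = collapse_radius y A z (infdist z (y ` frontier A))"
  by (auto simp: fun_eq_iff collapse_def collapse_radius_def Let_def)

text \<open>
  The point \<open>z\<close> and the radius \<open>\<rho>\<close> may move as long as the open ball of radius \<open>\<rho>\<close> around \<open>z\<close> never meets
  the image of the boundary.
\<close>

lemma collapse_radius_homotopy:
  fixes y :: "real ^ 'n \<Rightarrow> real ^ 'n"
  assumes A: "open A" "bounded A" and y: "continuous_on (closure A) y"
    and z: "continuous_on {0..1} z" and \<rho>: "continuous_on {0..1} \<rho>"
    and pos: "\<And>t. t \<in> {0..1} \<Longrightarrow> \<rho> t > 0"
    and far: "\<And>t x. t \<in> {0..1} \<Longrightarrow> x \<in> frontier A \<Longrightarrow> \<rho> t \<le> dist (y x) (z t)"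
  shows "homotopic_with (\<lambda>_. True) compactified compactified
           (collapse_radius y A (z 0) (\<rho> 0)) (collapse_radius y A (z 1) (\<rho> (1 :: real)))"
proof -
  define e where "e = (\<lambda>w. dist (y (snd w)) (z (fst w)))"
  define W where "W = {w \<in> {0..1} \<times> A. e w < \<rho> (fst w)}"
  define q where "q = (\<lambda>w. (y (snd w) - z (fst w)) /\<^sub>R (\<rho> (fst w) - e w))"
  define H where "H = (\<lambda>(t::real, p). case p of None \<Rightarrow> None
      | Some x \<Rightarrow> if (t, x) \<in> W then Some (q (t, x)) else None)"
  let ?Q = "{0..1::real} \<times> closure A"
  have cy: "continuous_on ?Q (\<lambda>w. y (snd w))"
    by (rule continuous_on_compose2 [OF y continuous_on_snd]) (auto intro: continuous_intros)
  have cz: "continuous_on ?Q (\<lambda>w. z (fst w))"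
    by (rule continuous_on_compose2 [OF z continuous_on_fst]) (auto intro: continuous_intros)
  have c\<rho>: "continuous_on ?Q (\<lambda>w. \<rho> (fst w))"
    by (rule continuous_on_compose2 [OF \<rho> continuous_on_fst]) (auto intro: continuous_intros)
  have ce: "continuous_on ?Q e"
    unfolding e_def by (intro continuous_on_dist cy cz)
  have WQ: "W \<subseteq> ?Q"
    using closure_subset by (auto simp: W_def)
  have cq: "continuous_on W q"
    unfolding q_def
    by (intro continuous_on_scaleR continuous_on_inverse continuous_on_diff
        continuous_on_subset [OF cy WQ] continuous_on_subset [OF cz WQ]
        continuous_on_subset [OF c\<rho> WQ] continuous_on_subset [OF ce WQ]) (auto simp: W_def)
  have "continuous_map (prod_topology (top_of_set {0..1}) compactified) compactified H"
    unfolding H_def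
  proof (rule continuous_map_into_compactified [OF _ cq])
    have "{0..1} \<times> A \<subseteq> ?Q"
      using closure_subset by auto
    then have "continuous_on ({0..1} \<times> A) (\<lambda>w. \<rho> (fst w) - e w)"
      by (intro continuous_on_diff continuous_on_subset [OF c\<rho>] continuous_on_subset [OF ce])
    then have "openin (top_of_set ({0..1} \<times> A)) (({0..1} \<times> A) \<inter> (\<lambda>w. \<rho> (fst w) - e w) -` {0<..})"
      by (intro continuous_openin_preimage_gen) auto
    moreover have "({0..1} \<times> A) \<inter> (\<lambda>w. \<rho> (fst w) - e w) -` {0<..} = W"
      by (auto simp: W_def)
    moreover have "openin (top_of_set ({0..1::real} \<times> UNIV)) ({0..1} \<times> A)"
      using A by (intro openin_Times) auto
    ultimately show "openin (top_of_set ({0..1} \<times> UNIV)) W"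
      by (simp only: openin_trans)
    fix C :: "(real ^ 'n) set"
    assume C: "compact C"
    obtain M where M: "M > 0" "\<And>c. c \<in> C \<Longrightarrow> norm c \<le> M"
      using compact_imp_bounded [OF C] unfolding bounded_pos by auto
    \<comment> \<open>On the preimage of \<open>C\<close> the denominator is at least \<open>\<rho> / (1 + M)\<close>, a closed condition.\<close>
    define K where "K = ?Q \<inter> (\<lambda>w. \<rho> (fst w) - e w - \<rho> (fst w) / (1 + M)) -` {0..}"
    have "closed ?Q"
      by (intro closed_Times) auto
    then have "closed K"
      unfolding K_def using M by (intro continuous_closed_preimage continuous_intros c\<rho> ce) auto
    moreover have "compact ?Q"
      using A by (intro compact_Times) auto
    moreover have "K = ?Q \<inter> K"
      unfolding K_def by auto
    ultimately have "compact K"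
      by (metis compact_Int_closed)
    have KW: "K \<subseteq> W"
    proof
      fix w assume w: "w \<in> K"
      then have t: "fst w \<in> {0..1}" and "snd w \<in> closure A"
          and "\<rho> (fst w) / (1 + M) \<le> \<rho> (fst w) - e w"
        by (auto simp: K_def)
      moreover have "\<rho> (fst w) / (1 + M) > 0"
        using pos t M by simp
      ultimately have "e w < \<rho> (fst w)"
        by linarith
      then have "snd w \<notin> frontier A"
        using far [OF t, of "snd w"] by (auto simp: e_def)
      then have "snd w \<in> A"
        using \<open>snd w \<in> closure A\<close> A by (auto simp: frontier_def interior_open)
      then show "w \<in> W"
        using t \<open>e w < \<rho> (fst w)\<close> by (auto simp: W_def mem_Times_iff)
    qed
    have "w \<in> K" if w: "w \<in> W" "q w \<in> C" for w
    proof -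
      have e: "e w < \<rho> (fst w)" using w by (simp add: W_def)
      have "e w / (\<rho> (fst w) - e w) \<le> M"
        using M(2) [OF w(2)] e by (simp add: q_def e_def dist_norm divide_inverse mult.commute)
      then have "e w \<le> M * (\<rho> (fst w) - e w)"
        using e by (simp add: pos_divide_le_eq)
      then have "\<rho> (fst w) \<le> (\<rho> (fst w) - e w) * (1 + M)"
        by (simp add: algebra_simps)
      then have "\<rho> (fst w) / (1 + M) \<le> \<rho> (fst w) - e w"
        using M by (simp add: pos_divide_le_eq)
      then show ?thesis
        using w WQ by (auto simp: K_def)
    qed
    then have "{w \<in> W. q w \<in> C} = K \<inter> q -` C"
      using KW by auto
    moreover have "closed (K \<inter> q -` C)"
      using \<open>closed K\<close> C by (intro continuous_closed_preimage continuous_on_subset [OF cq KW] compact_imp_closed [OF C])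
    ultimately show "compact {w \<in> W. q w \<in> C}"
      using \<open>compact K\<close> by (metis Int_left_absorb compact_Int_closed)
  qed
  moreover have "H (t, p) = collapse_radius y A (z t) (\<rho> t) p" if "t \<in> {0..1}" for t p
    using that by (auto simp: H_def W_def q_def e_def collapse_radius_def split: option.splits)
  ultimately show ?thesis
    unfolding homotopic_with_def by (intro exI [of _ H]) auto
qed

lemma far_from_compact_image:
  fixes y :: "'a::topological_space \<Rightarrow> 'b::heine_borel"
  assumes "compact S" "continuous_on S y" "z \<notin> y ` S"
  obtains d where "d > 0" "\<And>x. x \<in> S \<Longrightarrow> d \<le> dist (y x) z"
proof -
  have "closed (y ` S)"
    using assms by (simp add: compact_continuous_image compact_imp_closed)
  then obtain d where "d > 0" "\<forall>w \<in> y ` S. d \<le> dist z w"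
    using separate_point_closed assms(3) by metis
  with that show ?thesis by (metis dist_commute imageI)
qed

lemma bounded_frontier_eq_empty:
  fixes A :: "'a::euclidean_space set"
  assumes "bounded A" "frontier A = {}"
  shows "A = {}"
  using assms frontier_eq_empty not_bounded_UNIV by blast

lemma degree_on_eq_radius:
  fixes y :: "real ^ 'n \<Rightarrow> real ^ 'n"
  assumes A: "open A" "bounded A" and y: "continuous_on (closure A) y"
    and \<rho>: "\<rho> > 0" "\<And>x. x \<in> frontier A \<Longrightarrow> \<rho> \<le> dist (y x) z"
  shows "degree_on y A z = compactification_degree (collapse_radius y A z \<rho>)"
proof (cases "frontier A = {}")
  case True
  then have "A = {}"
    using A bounded_frontier_eq_empty by blast
  then have "collapse y A z = collapse_radius y A z \<rho>"
    by (auto simp: fun_eq_iff collapse_def collapse_radius_def Let_def split: option.splits)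
  then show ?thesis
    by (simp add: degree_on_def)
next
  case False
  define r where "r = infdist z (y ` frontier A)"
  have "z \<notin> y ` frontier A"
    using \<rho> by force
  then have r: "r > 0"
    unfolding r_def using infdist_frontier_pos A y False by blast
  have rfar: "r \<le> dist (y x) z" if "x \<in> frontier A" for x
    using that unfolding r_def by (metis dist_commute imageI infdist_le)
  have "homotopic_with (\<lambda>_. True) compactified compactified
          (collapse_radius y A z ((1 - 0) * r + 0 * \<rho>)) (collapse_radius y A z ((1 - 1) * r + 1 * \<rho>))"
  proof (rule collapse_radius_homotopy [OF A y, where z = "\<lambda>_. z" and \<rho> = "\<lambda>t. (1 - t) * r + t * \<rho>"])
    fix t :: real assume t: "t \<in> {0..1}"
    show "(1 - t) * r + t * \<rho> > 0"
      using t r \<rho>(1) by (cases "t = 0") (auto intro: add_nonneg_pos)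
    fix x assume "x \<in> frontier A"
    then have "(1 - t) * r + t * \<rho> \<le> (1 - t) * dist (y x) z + t * dist (y x) z"
      using t rfar \<rho> by (intro add_mono mult_left_mono) auto
    then show "(1 - t) * r + t * \<rho> \<le> dist (y x) z"
      by (simp add: algebra_simps)
  qed (intro continuous_intros)+
  then show ?thesis
    by (simp add: degree_on_def collapse_eq_collapse_radius r_def compactification_degree_homotopic)
qed

lemma degree_on_locally_constant:
  fixes y :: "real ^ 'n \<Rightarrow> real ^ 'n"
  assumes A: "open A" "bounded A" and y: "continuous_on (closure A) y" and z: "z \<notin> y ` frontier A"
  obtains e where "e > 0"
    and "\<And>w. w \<in> ball z e \<Longrightarrow> w \<notin> y ` frontier A"
    and "\<And>w. w \<in> ball z e \<Longrightarrow> degree_on y A w = degree_on y A z"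
proof -
  have "compact (frontier A)"
    using A(2) by (rule compact_frontier_bounded)
  moreover have "continuous_on (frontier A) y"
    using y by (rule continuous_on_subset) (simp add: frontier_def)
  ultimately obtain d where d: "d > 0" "\<And>x. x \<in> frontier A \<Longrightarrow> d \<le> dist (y x) z"
    using far_from_compact_image z by metis
  have far: "d / 2 \<le> dist (y x) w" if "w \<in> ball z (d / 2)" "x \<in> frontier A" for w x
    using d(2) [OF that(2)] that(1) dist_triangle [of "y x" z w] by (simp add: dist_commute)
  show ?thesis
  proof
    show "d / 2 > 0" using d by simp
    fix w assume w: "w \<in> ball z (d / 2)"
    then show "w \<notin> y ` frontier A"
      using far [OF w] d(1) by force
    have "homotopic_with (\<lambda>_. True) compactified compactified
            (collapse_radius y A ((1 - 0) *\<^sub>R w + 0 *\<^sub>R z) (d / 2))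
            (collapse_radius y A ((1 - 1) *\<^sub>R w + 1 *\<^sub>R z) (d / 2))"
    proof (rule collapse_radius_homotopy [OF A y,
          where z = "\<lambda>t. (1 - t) *\<^sub>R w + t *\<^sub>R z" and \<rho> = "\<lambda>_. d / 2"])
      fix t :: real and x assume t: "t \<in> {0..1}" and x: "x \<in> frontier A"
      have "(1 - t) *\<^sub>R w + t *\<^sub>R z \<in> ball z (d / 2)"
        using w d t by (intro convexD_alt convex_ball) (auto simp: convex_ball)
      then show "d / 2 \<le> dist (y x) ((1 - t) *\<^sub>R w + t *\<^sub>R z)"
        using far x by blast
    qed (use d in \<open>auto intro!: continuous_intros\<close>)
    then have "compactification_degree (collapse_radius y A w (d / 2)) =
        compactification_degree (collapse_radius y A z (d / 2))"
      by (simp add: compactification_degree_homotopic)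
    moreover have "degree_on y A v = compactification_degree (collapse_radius y A v (d / 2))"
      if "v \<in> ball z (d / 2)" for v
      using far [OF that] d by (intro degree_on_eq_radius A y) auto
    ultimately show "degree_on y A w = degree_on y A z"
      using w d by simp
  qed
qed

lemma continuous_map_collapse_radius:
  fixes y :: "real ^ 'n \<Rightarrow> real ^ 'n"
  assumes "open A" "bounded A" "continuous_on (closure A) y"
    and "\<rho> > 0" "\<And>x. x \<in> frontier A \<Longrightarrow> \<rho> \<le> dist (y x) z"
  shows "continuous_map compactified compactified (collapse_radius y A z \<rho>)"
  using homotopic_with_imp_continuous_maps
    [OF collapse_radius_homotopy [of A y "\<lambda>_. z" "\<lambda>_. \<rho>"]] assms by auto

text \<open>
  Additivity and, for \<open>A2 = {}\<close>, excision.  For a small radius the collapse of \<open>A\<close> is supported in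
  two bounded sets \<open>D A1\<close> and \<open>D A2\<close> whose closures stay inside \<open>A1\<close> and \<open>A2\<close>.
\<close>

lemma degree_on_additive:
  fixes y :: "real ^ 'n \<Rightarrow> real ^ 'n"
  assumes A: "open A" "bounded A" and y: "continuous_on (closure A) y"
    and sub: "open A1" "open A2" "A1 \<subseteq> A" "A2 \<subseteq> A" "A1 \<inter> A2 = {}"
    and z: "z \<notin> y ` (closure A - (A1 \<union> A2))"
  shows "degree_on y A z = degree_on y A1 z + degree_on y A2 z"
proof -
  let ?N = "closure A - (A1 \<union> A2)"
  have "compact ?N"
    using A sub by (intro compact_diff) auto
  moreover have "continuous_on ?N y"
    using y by (rule continuous_on_subset) auto
  ultimately obtain d where d: "d > 0" "\<And>x. x \<in> ?N \<Longrightarrow> d \<le> dist (y x) z"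
    using far_from_compact_image z by metis
  \<comment> \<open>The radius is strictly below \<open>d\<close>, so that the closures of the supports avoid the boundaries.\<close>
  define \<rho> where "\<rho> = d / 2"
  have \<rho>: "\<rho> > 0" "\<rho> < d"
    using d by (auto simp: \<rho>_def)
  have cl: "closure A1 \<subseteq> closure A" "closure A2 \<subseteq> closure A"
    using sub by (simp_all add: closure_mono)
  have "closure A1 \<inter> A2 = {}" "A1 \<inter> closure A2 = {}"
    using sub by (simp_all add: open_Int_closure_eq_empty Int_commute)
  then have fr: "frontier A \<subseteq> ?N" "frontier A1 \<subseteq> ?N" "frontier A2 \<subseteq> ?N"
    using A sub cl by (auto simp: frontier_def interior_open)
  have near: "d \<le> dist (y x) z" if "x \<in> frontier A \<union> frontier A1 \<union> frontier A2" for x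
    using that fr d by blast
  have bd: "bounded A1" "bounded A2" and yc: "continuous_on (closure A1) y" "continuous_on (closure A2) y"
    using A sub y cl bounded_subset continuous_on_subset by blast+
  have deg: "degree_on y B z = compactification_degree (collapse_radius y B z \<rho>)"
     and cont: "continuous_map compactified compactified (collapse_radius y B z \<rho>)" if "B \<in> {A, A1, A2}" for B
    using that A sub y bd yc \<rho> near
    by (auto intro!: degree_on_eq_radius continuous_map_collapse_radius intro: order_trans [OF less_imp_le])
  define D where "D = (\<lambda>B. {x \<in> B. dist (y x) z < \<rho>})"
  have closD: "closure (D B) \<subseteq> B" if "B \<in> {A1, A2}" for B
  proof -
    have B: "open B" "closure B \<subseteq> closure A" "frontier B \<subseteq> ?N"
      using that sub cl fr by auto
    have "closed (closure B \<inter> (\<lambda>x. dist (y x) z) -` {..\<rho>})"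
      using B y by (intro continuous_closed_preimage continuous_intros) (auto intro: continuous_on_subset)
    then have "closure (D B) \<subseteq> closure B \<inter> (\<lambda>x. dist (y x) z) -` {..\<rho>}"
      using closure_subset by (intro closure_minimal) (auto simp: D_def)
    moreover have "x \<notin> frontier B" if "dist (y x) z \<le> \<rho>" for x
      using that d(2) [of x] B \<rho> by force
    ultimately show ?thesis
      using B(1) by (fastforce simp: frontier_def interior_open)
  qed
  have cover: "x \<in> A1 \<union> A2" if "x \<in> A" "dist (y x) z < \<rho>" for x
    using that d(2) [of x] \<rho> closure_subset by force
  have "compactification_degree (collapse_radius y A z \<rho>) =
      compactification_degree (collapse_radius y A1 z \<rho>) + compactification_degree (collapse_radius y A2 z \<rho>)"
  proof (rule compactification_degree_additive [where ?D1.0 = "D A1" and ?D2.0 = "D A2"])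
    show "bounded (D A1)" "bounded (D A2)"
      using bd by (auto simp: D_def intro: bounded_subset)
    show "closure (D A1) \<inter> closure (D A2) = {}"
      using closD [of A1] closD [of A2] sub by auto
    fix p
    show "p \<notin> Some ` D A2 \<Longrightarrow> collapse_radius y A z \<rho> p = collapse_radius y A1 z \<rho> p"
      "p \<notin> Some ` D A2 \<Longrightarrow> collapse_radius y A2 z \<rho> p = None"
      "p \<notin> Some ` D A1 \<Longrightarrow> collapse_radius y A z \<rho> p = collapse_radius y A2 z \<rho> p"
      "p \<notin> Some ` D A1 \<Longrightarrow> collapse_radius y A1 z \<rho> p = None"
      using cover sub by (cases p; auto simp: collapse_radius_def D_def)+
  qed (use cont in auto)
  then show ?thesis
    by (simp add: deg)
qed

section \<open>The degree of orientation preserving maps\<close>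

lemma compact_subset_open_shrink:
  fixes K W :: "'a::euclidean_space set"
  assumes "compact K" "open W" "K \<subseteq> W"
  obtains A where "open A" "compact (closure A)" "K \<subseteq> A" "closure A \<subseteq> W"
proof -
  obtain R where R: "K \<subseteq> ball 0 R"
    using assms compact_imp_bounded bounded_subset_ballD by metis
  have "closed K" "closed (- (W \<inter> ball 0 R))" "K \<inter> - (W \<inter> ball 0 R) = {}"
    using assms R by (auto simp: compact_imp_closed simp del: Compl_Int)
  then obtain A B where AB: "open A" "open B" "K \<subseteq> A" "- (W \<inter> ball 0 R) \<subseteq> B" "A \<inter> B = {}"
    by (rule separation_normal)
  have "closure A \<subseteq> - B"
    using AB by (intro closure_minimal) auto
  then have "closure A \<subseteq> W \<inter> ball 0 R"
    using AB by auto
  moreover from this have "compact (closure A)"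
    by (metis bounded_ball bounded_subset closed_closure compact_eq_bounded_closed inf.boundedE)
  ultimately show ?thesis
    using AB that by auto
qed

lemma closure_Int_fibre:
  fixes y :: "real ^ 'n \<Rightarrow> real ^ 'n"
  assumes "open W" "z \<notin> y ` frontier W"
  shows "closure W \<inter> y -` {z} = W \<inter> y -` {z}"
proof (intro equalityI subsetI)
  fix x assume x: "x \<in> closure W \<inter> y -` {z}"
  then have "x \<notin> frontier W"
    using assms(2) by (metis IntD2 imageI vimage_singleton_eq)
  with x show "x \<in> W \<inter> y -` {z}"
    using assms(1) by (simp add: frontier_def interior_open)
qed (use closure_subset in auto)

lemma exists_compactly_inside_fibre:
  fixes y :: "real ^ 'n \<Rightarrow> real ^ 'n"
  assumes W: "open W" "bounded W" "W \<subseteq> \<Omega>" "continuous_on (closure W) y"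
    and z: "z \<notin> y ` frontier W"
  obtains A where "A \<in> compactly_inside \<Omega>" "A \<subseteq> W" "W \<inter> y -` {z} \<subseteq> A" "z \<notin> y ` frontier A"
proof -
  let ?K = "W \<inter> y -` {z}"
  note cl = closure_Int_fibre [OF W(1) z]
  have "closed (closure W \<inter> y -` {z})"
    using W by (intro continuous_closed_preimage) auto
  moreover have "bounded ?K"
    using W(2) by (rule bounded_subset) auto
  ultimately have "compact ?K"
    by (simp add: cl compact_eq_bounded_closed)
  then obtain A where A: "open A" "compact (closure A)" "?K \<subseteq> A" "closure A \<subseteq> W"
    using W(1) compact_subset_open_shrink [of ?K W] by auto
  have "z \<notin> y ` frontier A"
    using A(1,3,4) by (auto simp: frontier_def interior_open)
  moreover have "A \<in> compactly_inside \<Omega>" "A \<subseteq> W"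
    using A W(3) closure_subset [of A] by (auto simp: compactly_inside_def)
  ultimately show ?thesis
    using A(3) that by blast
qed

text \<open>
  Nonnegativity, assumed for sets that are compactly inside \<open>\<Omega>\<close>, extends to open sets \<open>W\<close> that
  touch the boundary of \<open>\<Omega>\<close>: only a neighbourhood of the compact fibre over \<open>z\<close> matters.
\<close>

lemma degree_on_nonneg:
  fixes y :: "real ^ 'n \<Rightarrow> real ^ 'n"
  assumes y: "orientation_preserving_on \<Omega> y"
    and W: "open W" "bounded W" "W \<subseteq> \<Omega>" "continuous_on (closure W) y"
    and z: "z \<notin> y ` frontier W"
  shows "degree_on y W z \<ge> 0"
proof -
  obtain A where A: "A \<in> compactly_inside \<Omega>" "A \<subseteq> W" "W \<inter> y -` {z} \<subseteq> A" "z \<notin> y ` frontier A"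
    using exists_compactly_inside_fibre [OF W z] by metis
  have "z \<notin> y ` (closure W - (A \<union> {}))"
    using A(3) closure_Int_fibre [OF W(1) z] by auto
  then have "degree_on y W z = degree_on y A z + degree_on y {} z"
    using A by (intro degree_on_additive W) (auto simp: compactly_inside_def)
  moreover have "degree_on y {} z = 0"
    by (intro degree_on_eq_0) auto
  ultimately show ?thesis
    using y A by (simp add: orientation_preserving_on_def)
qed

lemma degree_on_superadditive:
  fixes y :: "real ^ 'n \<Rightarrow> real ^ 'n"
  assumes y: "orientation_preserving_on \<Omega> y"
    and W: "open W" "bounded W" "W \<subseteq> \<Omega>" "continuous_on (closure W) y"
    and z: "z \<notin> y ` frontier W"
    and sub: "open A" "open B" "A \<subseteq> W" "B \<subseteq> W" "A \<inter> B = {}"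
    and zAB: "z \<notin> y ` frontier A" "z \<notin> y ` frontier B"
  shows "degree_on y A z + degree_on y B z \<le> degree_on y W z"
proof -
  define C where "C = W - closure (A \<union> B)"
  have C: "open C" "C \<subseteq> W"
    using W by (auto simp: C_def)
  have AB: "closure (A \<union> B) \<subseteq> closure W"
    using sub by (intro closure_mono) auto
  have frAB: "closure (A \<union> B) - (A \<union> B) \<subseteq> frontier A \<union> frontier B"
    using sub by (auto simp: frontier_def interior_open)
  have "frontier C \<subseteq> frontier W \<union> (closure (A \<union> B) - (A \<union> B))"
  proof -
    have "C \<subseteq> - (A \<union> B)"
      using closure_subset [of "A \<union> B"] by (auto simp: C_def)
    then have "closure C \<subseteq> - (A \<union> B)"
      using sub by (intro closure_minimal) auto
    moreover have "closure C \<subseteq> closure W"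
      using C by (simp add: closure_mono)
    moreover have "interior C = C" "interior W = W"
      using C W by (simp_all add: interior_open)
    ultimately show ?thesis
      unfolding frontier_def by (auto simp: C_def)
  qed
  then have zC: "z \<notin> y ` frontier C"
    using frAB z zAB by blast
  have "bounded C" "C \<subseteq> \<Omega>"
    using W C by (auto intro: bounded_subset)
  moreover have "continuous_on (closure C) y"
    using W(4) closure_mono [OF C(2)] by (rule continuous_on_subset)
  ultimately have "degree_on y C z \<ge> 0"
    using degree_on_nonneg y C(1) zC by blast
  moreover have "degree_on y W z = degree_on y (A \<union> B) z + degree_on y C z"
  proof (rule degree_on_additive)
    have "closure W - ((A \<union> B) \<union> C) \<subseteq> frontier W \<union> (closure (A \<union> B) - (A \<union> B))"
      using W by (auto simp: C_def frontier_def interior_open)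
    then show "z \<notin> y ` (closure W - ((A \<union> B) \<union> C))"
      using frAB z zAB by blast
    show "(A \<union> B) \<inter> C = {}"
      using closure_subset [of "A \<union> B"] by (auto simp: C_def)
  qed (use W C sub in auto)
  moreover have "degree_on y (A \<union> B) z = degree_on y A z + degree_on y B z"
  proof (rule degree_on_additive)
    show "bounded (A \<union> B)"
      using W sub by (meson Un_least bounded_subset)
    show "continuous_on (closure (A \<union> B)) y"
      using W(4) AB by (rule continuous_on_subset)
    show "z \<notin> y ` (closure (A \<union> B) - (A \<union> B))"
      using frAB zAB by blast
  qed (use sub in auto)
  ultimately show ?thesis
    by simp
qed

lemma degree_on_mono:
  fixes y :: "real ^ 'n \<Rightarrow> real ^ 'n"
  assumes "orientation_preserving_on \<Omega> y"
    and "open W" "bounded W" "W \<subseteq> \<Omega>" "continuous_on (closure W) y"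
    and "z \<notin> y ` frontier W" and "open A" "A \<subseteq> W" "z \<notin> y ` frontier A"
  shows "degree_on y A z \<le> degree_on y W z"
proof -
  have "degree_on y A z + degree_on y {} z \<le> degree_on y W z"
    using assms by (intro degree_on_superadditive [of \<Omega>]) auto
  moreover have "degree_on y {} z = 0"
    by (intro degree_on_eq_0) auto
  ultimately show ?thesis
    by simp
qed

lemma degree_on_nonzero_imp_image:
  fixes y :: "real ^ 'n \<Rightarrow> real ^ 'n"
  assumes A: "open A" "bounded A" and y: "continuous_on (closure A) y"
    and z: "z \<notin> y ` frontier A" "degree_on y A z \<noteq> 0"
  shows "z \<in> y ` A"
proof -
  have "z \<in> y ` closure A"
    using degree_on_eq_0 [OF A y] z by blast
  then show ?thesis
    using z A by (auto simp: frontier_def interior_open)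
qed

lemma compactly_insideD:
  assumes "A \<in> compactly_inside \<Omega>" "continuous_on \<Omega> y"
  shows "open A" "bounded A" "A \<subseteq> \<Omega>" "continuous_on (closure A) y"
proof -
  have A: "open A" "compact (closure A)" "closure A \<subseteq> \<Omega>"
    using assms(1) by (simp_all add: compactly_inside_def)
  show "open A" by (rule A)
  show "bounded A" using A(2) by (simp only: compact_closure)
  show "A \<subseteq> \<Omega>" using closure_subset A(3) by (rule subset_trans)
  show "continuous_on (closure A) y" using assms(2) A(3) by (rule continuous_on_subset)
qed

lemma exists_degree_on_pos:
  fixes y :: "real ^ 'n \<Rightarrow> real ^ 'n"
  assumes y: "strictly_orientation_preserving_on \<Omega> y" "continuous_on \<Omega> y"
    and V: "open V" "V \<noteq> {}" "V \<subseteq> \<Omega>"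
  obtains A z where "A \<in> compactly_inside \<Omega>" "A \<subseteq> V" "z \<notin> y ` frontier A"
    "degree_on y A z \<ge> 1" "z \<in> y ` A"
proof -
  obtain x where "x \<in> V"
    using V by blast
  then obtain B where B: "open B" "compact (closure B)" "{x} \<subseteq> B" "closure B \<subseteq> V"
    using compact_subset_open_shrink [of "{x}" V] V by auto
  then have "B \<in> compactly_inside \<Omega>" "B \<noteq> {}"
    using V by (auto simp: compactly_inside_def)
  then obtain A z where Az: "A \<in> compactly_inside \<Omega>" "A \<subseteq> B" "z \<notin> y ` frontier A" "degree_on y A z \<noteq> 0"
    using y(1) unfolding strictly_orientation_preserving_on_def nondegenerate_on_def by blast
  moreover have "degree_on y A z \<ge> 0"
    using y Az by (auto simp: strictly_orientation_preserving_on_def orientation_preserving_on_def)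
  moreover have "z \<in> y ` A"
    using degree_on_nonzero_imp_image compactly_insideD [OF Az(1) y(2)] Az by blast
  moreover have "A \<subseteq> V"
    using Az(2) B(4) closure_subset by blast
  ultimately show ?thesis
    using that by force
qed

text \<open>
  Nondegeneracy provides, near \<open>x\<close>, a set \<open>A\<close> of positive degree at some \<open>z\<close> near \<open>y x\<close>; by
  monotonicity \<open>W\<close> has positive degree at \<open>z\<close>, and by local constancy also at \<open>y x\<close>.
\<close>

lemma degree_on_pos:
  fixes y :: "real ^ 'n \<Rightarrow> real ^ 'n"
  assumes y: "strictly_orientation_preserving_on \<Omega> y" "continuous_on \<Omega> y"
    and W: "open W" "bounded W" "W \<subseteq> \<Omega>" "continuous_on (closure W) y"
    and x: "x \<in> W" "y x \<notin> y ` frontier W"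
  shows "degree_on y W (y x) \<ge> 1"
proof -
  have op: "orientation_preserving_on \<Omega> y"
    using y by (simp add: strictly_orientation_preserving_on_def)
  obtain e where e: "e > 0" "\<And>w. w \<in> ball (y x) e \<Longrightarrow> w \<notin> y ` frontier W"
      "\<And>w. w \<in> ball (y x) e \<Longrightarrow> degree_on y W w = degree_on y W (y x)"
    using degree_on_locally_constant [OF W(1,2,4) x(2)] by metis
  define V where "V = W \<inter> y -` ball (y x) e"
  have "open V"
    unfolding V_def using W closure_subset
    by (intro continuous_open_preimage) (auto intro: continuous_on_subset)
  moreover have "x \<in> V" "V \<subseteq> W"
    using x e by (auto simp: V_def)
  ultimately obtain A z where A: "A \<in> compactly_inside \<Omega>" "A \<subseteq> V" "z \<notin> y ` frontier A"
      "degree_on y A z \<ge> 1" "z \<in> y ` A"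
    using exists_degree_on_pos [OF y, of V] W(3) by blast
  then have z: "z \<in> ball (y x) e"
    by (auto simp: V_def)
  have "open A"
    using A by (simp add: compactly_inside_def)
  then have "degree_on y A z \<le> degree_on y W z"
    using A \<open>V \<subseteq> W\<close> e(2) [OF z] by (intro degree_on_mono [OF op W]) auto
  then show ?thesis
    using A e(3) [OF z] by simp
qed

section \<open>Reduced domains, local images and fibres\<close>

lemma reduced_domainI:
  fixes y :: "real ^ 'n \<Rightarrow> real ^ 'n"
  assumes U: "open U" "bounded U" "U \<subseteq> \<Omega>" "continuous_on (closure U) y"
    and x: "x \<in> U" "y x \<notin> y ` frontier U"
  shows "x \<in> reduced_domain \<Omega> y U"
proof -
  obtain A where "A \<in> compactly_inside \<Omega>" "A \<subseteq> U" "U \<inter> y -` {y x} \<subseteq> A" "y x \<notin> y ` frontier A"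
    using exists_compactly_inside_fibre [OF U x(2)] by metis
  then show ?thesis
    using x(1) by (auto simp: reduced_domain_def)
qed

lemma reduced_domain_image_im_loc:
  fixes y :: "real ^ 'n \<Rightarrow> real ^ 'n"
  assumes y: "strictly_orientation_preserving_on \<Omega> y" "continuous_on \<Omega> y"
    and x: "x \<in> reduced_domain \<Omega> y U"
  shows "y x \<in> im_loc \<Omega> y U"
proof -
  obtain A where A: "A \<in> compactly_inside \<Omega>" "x \<in> A" "A \<subseteq> U" "y x \<notin> y ` frontier A"
    using x by (auto simp: reduced_domain_def)
  then have "degree_on y A (y x) \<ge> 1"
    using degree_on_pos [OF y] compactly_insideD [OF A(1) y(2)] by blast
  then show ?thesis
    using A by (auto simp: im_loc_def im_T_def)
qed

lemma im_loc_subset_image: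
  fixes y :: "real ^ 'n \<Rightarrow> real ^ 'n"
  assumes "continuous_on \<Omega> y"
  shows "im_loc \<Omega> y U \<subseteq> y ` U"
proof
  fix z assume "z \<in> im_loc \<Omega> y U"
  then obtain A where A: "A \<in> compactly_inside \<Omega>" "A \<subseteq> U" "z \<notin> y ` frontier A" "degree_on y A z \<noteq> 0"
    by (auto simp: im_loc_def im_T_def)
  then show "z \<in> y ` U"
    using degree_on_nonzero_imp_image [of A y z] compactly_insideD [OF A(1) assms] by blast
qed

lemma open_im_T:
  fixes y :: "real ^ 'n \<Rightarrow> real ^ 'n"
  assumes "open A" "bounded A" "continuous_on (closure A) y"
  shows "open (im_T y A)"
  unfolding open_contains_ball
proof
  fix z assume z: "z \<in> im_T y A"
  then have "z \<notin> y ` frontier A"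
    by (simp add: im_T_def)
  from degree_on_locally_constant [OF assms this]
  obtain e where e: "e > 0" "\<And>w. w \<in> ball z e \<Longrightarrow> w \<notin> y ` frontier A"
      "\<And>w. w \<in> ball z e \<Longrightarrow> degree_on y A w = degree_on y A z"
    by metis
  have "ball z e \<subseteq> im_T y A"
  proof
    fix w assume w: "w \<in> ball z e"
    show "w \<in> im_T y A"
      using e(2) [OF w] e(3) [OF w] z by (simp add: im_T_def)
  qed
  with e(1) show "\<exists>e>0. ball z e \<subseteq> im_T y A"
    by blast
qed

text \<open>
  If the fibre over \<open>z\<close> split into two closed pieces, disjoint open neighbourhoods of the pieces
  would each contribute at least \<open>1\<close> to the degree.
\<close>

lemma fibre_connected:
  fixes y :: "real ^ 'n \<Rightarrow> real ^ 'n"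
  assumes y: "strictly_orientation_preserving_on \<Omega> y" "continuous_on \<Omega> y"
    and U: "open U" "bounded U" "U \<subseteq> \<Omega>" "continuous_on (closure U) y"
    and z: "z \<notin> y ` frontier U" and deg: "degree_on y U z \<le> 1"
  shows "connected (U \<inter> y -` {z})"
proof -
  let ?K = "U \<inter> y -` {z}"
  note cl = closure_Int_fibre [OF U(1) z]
  have "closed (closure U \<inter> y -` {z})"
    using U by (intro continuous_closed_preimage) auto
  then have "closed ?K"
    by (simp add: cl)
  moreover have False
    if K: "closed K1" "closed K2" "K1 \<union> K2 = ?K" "K1 \<inter> K2 = {}" "K1 \<noteq> {}" "K2 \<noteq> {}" for K1 K2
  proof -
    obtain P1 P2 where P: "open P1" "open P2" "K1 \<subseteq> P1" "K2 \<subseteq> P2" "P1 \<inter> P2 = {}"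
      using separation_normal K by metis
    have pos: "degree_on y (U \<inter> P) z \<ge> 1"
      if P: "open P" "open Q" "P \<inter> Q = {}" "?K \<subseteq> P \<union> Q" "x \<in> ?K" "x \<in> P" for P Q x
    proof -
      have clU: "closure (U \<inter> P) \<subseteq> closure U"
        by (simp add: closure_mono)
      have clQ: "closure (U \<inter> P) \<subseteq> - Q"
        using P by (intro closure_minimal) auto
      have ne: "y v \<noteq> z" if "v \<in> frontier (U \<inter> P)" for v
      proof
        assume "y v = z"
        moreover have v: "v \<in> closure (U \<inter> P)" "v \<notin> U \<inter> P"
          using that U(1) P(1) by (simp_all add: frontier_def interior_open open_Int)
        ultimately have "v \<in> ?K"
          using clU cl by blast
        then show False
          using P(4) v clQ by blast
      qed
      have x: "y x = z" "x \<in> U \<inter> P"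
        using P by auto
      have "degree_on y (U \<inter> P) (y x) \<ge> 1"
      proof (rule degree_on_pos [OF y])
        show "y x \<notin> y ` frontier (U \<inter> P)"
          using ne unfolding x(1) by blast
        show "bounded (U \<inter> P)"
          using U(2) by (rule bounded_subset) auto
        show "continuous_on (closure (U \<inter> P)) y"
          using U(4) clU by (rule continuous_on_subset)
      qed (use x U P in auto)
      then show ?thesis
        by (simp only: x(1))
    qed
    obtain x1 x2 where x: "x1 \<in> K1" "x2 \<in> K2"
      using K by blast
    have cover: "?K \<subseteq> P1 \<union> P2" "?K \<subseteq> P2 \<union> P1" "x1 \<in> ?K" "x1 \<in> P1" "x2 \<in> ?K" "x2 \<in> P2" "P2 \<inter> P1 = {}"
      using K(3) P x by auto
    have "degree_on y (U \<inter> P1) z \<ge> 1"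
      by (rule pos [OF P(1,2,5) cover(1,3,4)])
    moreover have "degree_on y (U \<inter> P2) z \<ge> 1"
      by (rule pos [OF P(2,1) cover(7,2,5,6)])
    moreover have "degree_on y U z = degree_on y (U \<inter> P1) z + degree_on y (U \<inter> P2) z"
    proof (rule degree_on_additive [OF U(1,2,4)])
      show "z \<notin> y ` (closure U - (U \<inter> P1 \<union> U \<inter> P2))"
        using cl cover(1) by auto
    qed (use P U in auto)
    ultimately show False
      using deg by simp
  qed
  ultimately show ?thesis
    by (simp add: connected_closed_set) metis
qed

text \<open>
  The boundary point \<open>x\<close> of \<open>U\<close> need not lie in \<open>\<Omega>\<close>, so nondegeneracy cannot be used at \<open>x\<close>
  itself, but only in the part of \<open>U\<close> near \<open>x\<close>.
\<close>

lemma exists_degree_on_pos_near_frontier: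
  fixes y :: "real ^ 'n \<Rightarrow> real ^ 'n"
  assumes y: "strictly_orientation_preserving_on \<Omega> y" "continuous_on \<Omega> y"
    and U: "open U" "U \<subseteq> \<Omega>" "continuous_on (closure U) y"
    and x: "x \<in> frontier U" and N: "open N" "x \<in> N" and e: "e > 0"
  obtains A z where "A \<in> compactly_inside \<Omega>" "A \<subseteq> U \<inter> N" "z \<notin> y ` frontier A"
    "degree_on y A z \<ge> 1" "z \<in> ball (y x) e"
proof -
  have "x \<in> closure U"
    using x by (simp add: frontier_def)
  then obtain d where d: "d > 0" "\<And>v. v \<in> closure U \<Longrightarrow> dist v x < d \<Longrightarrow> dist (y v) (y x) < e"
    using U(3) e unfolding continuous_on_iff by metis
  define V where "V = U \<inter> (N \<inter> ball x d)"
  have "U \<inter> (N \<inter> ball x d) \<noteq> {}"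
    using \<open>x \<in> closure U\<close> N d by (metis IntI centre_in_ball closure_iff_nhds_not_empty open_Int open_ball order_refl inf_commute)
  then have V: "open V" "V \<noteq> {}" "V \<subseteq> \<Omega>"
    using U N by (auto simp: V_def)
  obtain A z where A: "A \<in> compactly_inside \<Omega>" "A \<subseteq> V" "z \<notin> y ` frontier A" "degree_on y A z \<ge> 1" "z \<in> y ` A"
    using exists_degree_on_pos [OF y V] by metis
  have "dist (y x) (y v) < e" if "v \<in> V" for v
    using that d(2) [of v] closure_subset by (auto simp: V_def dist_commute)
  then have "z \<in> ball (y x) e"
    using A by auto
  with A that show ?thesis
    by (auto simp: V_def)
qed

text \<open>
  If \<open>y x\<close>, with \<open>x\<close> on the boundary of \<open>U\<close>, had positive degree for some \<open>A\<close>, then there would be a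
  set \<open>B\<close> close to \<open>x\<close>, hence disjoint from \<open>A\<close>, of positive degree at values close to \<open>y x\<close>.  Some of these
  values \<open>w\<close> avoid \<open>y ` frontier U\<close>, because that set has empty interior, and there \<open>U\<close> would have
  degree at least \<open>2\<close>.
\<close>

lemma im_loc_disjoint_image_frontier:
  fixes y :: "real ^ 'n \<Rightarrow> real ^ 'n"
  assumes y: "strictly_orientation_preserving_on \<Omega> y" "continuous_on \<Omega> y"
    and U: "open U" "bounded U" "U \<subseteq> \<Omega>" "continuous_on (closure U) y"
    and deg: "\<And>z. z \<notin> y ` frontier U \<Longrightarrow> degree_on y U z \<le> 1"
    and int: "interior (y ` frontier U) = {}"
  shows "im_loc \<Omega> y U \<inter> y ` frontier U = {}"
proof (rule ccontr)
  assume "im_loc \<Omega> y U \<inter> y ` frontier U \<noteq> {}"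
  then obtain A x where A: "A \<in> compactly_inside \<Omega>" "A \<subseteq> U"
      and yx: "y x \<notin> y ` frontier A" "degree_on y A (y x) \<noteq> 0" and x: "x \<in> frontier U"
    by (auto simp: im_loc_def im_T_def)
  have op: "orientation_preserving_on \<Omega> y"
    using y by (simp add: strictly_orientation_preserving_on_def)
  note A' = compactly_insideD [OF A(1) y(2)]
  obtain e where e: "e > 0" "\<And>w. w \<in> ball (y x) e \<Longrightarrow> w \<notin> y ` frontier A"
      "\<And>w. w \<in> ball (y x) e \<Longrightarrow> degree_on y A w = degree_on y A (y x)"
    using degree_on_locally_constant [OF A'(1,2,4) yx(1)] by metis
  have "x \<notin> closure A"
    using x yx(1) A(2) A'(1) U(1) by (auto simp: frontier_def interior_open)
  then obtain B z where B: "B \<in> compactly_inside \<Omega>" "B \<subseteq> U \<inter> (- closure A)" "z \<notin> y ` frontier B"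
    "degree_on y B z \<ge> 1" "z \<in> ball (y x) e"
    using exists_degree_on_pos_near_frontier [OF y U(1,3,4) x _ _ e(1), of "- closure A"]
    by (metis ComplI closed_closure open_Compl)
  note B' = compactly_insideD [OF B(1) y(2)]
  obtain r where r: "r > 0" "\<And>w. w \<in> ball z r \<Longrightarrow> w \<notin> y ` frontier B"
      "\<And>w. w \<in> ball z r \<Longrightarrow> degree_on y B w = degree_on y B z"
    using degree_on_locally_constant [OF B'(1,2,4) B(3)] by metis
  have "\<not> ball z r \<inter> ball (y x) e \<subseteq> y ` frontier U"
  proof
    assume "ball z r \<inter> ball (y x) e \<subseteq> y ` frontier U"
    then have "ball z r \<inter> ball (y x) e \<subseteq> interior (y ` frontier U)"
      by (intro interior_maximal open_Int open_ball)
    moreover have "z \<in> ball z r \<inter> ball (y x) e"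
      using B(5) r(1) by simp
    ultimately show False
      using int by blast
  qed
  then obtain w where w: "w \<in> ball z r" "w \<in> ball (y x) e" "w \<notin> y ` frontier U"
    by blast
  have "degree_on y A w + degree_on y B w \<le> degree_on y U w"
    using A(2) A'(1) B(2) B'(1) closure_subset [of A] w e(2) r(2)
    by (intro degree_on_superadditive [OF op U]) auto
  moreover have "degree_on y A w \<ge> 1"
  proof -
    have "degree_on y A w \<noteq> 0"
      using e(3) [OF w(2)] yx(2) by simp
    moreover have "degree_on y A w \<ge> 0"
      using e(2) [OF w(2)] op A(1) by (simp add: orientation_preserving_on_def)
    ultimately show ?thesis by simp
  qed
  moreover have "degree_on y B w \<ge> 1"
    using r(3) [OF w(1)] B(4) by simp
  ultimately show False
    using deg [OF w(3)] by simp
qed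

text \<open>
  Both kinds of admissible \<open>U\<close> (compactly inside \<open>\<Omega>\<close>, or all of a bounded \<open>\<Omega>\<close>) are covered by
  assuming only that \<open>y\<close> is continuous on the closure of a bounded open \<open>U \<subseteq> \<Omega>\<close>.
\<close>

theorem degree_le_1_consequences:
  fixes \<Omega> U :: "(real ^ 'n) set" and y :: "real ^ 'n \<Rightarrow> real ^ 'n"
  assumes y: "strictly_orientation_preserving_on \<Omega> y" "continuous_on \<Omega> y"
    and U: "open U" "bounded U" "U \<subseteq> \<Omega>" "continuous_on (closure U) y"
    and deg: "\<And>z. z \<notin> y ` frontier U \<Longrightarrow> degree_on y U z \<le> 1"
  shows degree_on_le_1: "\<And>A z. \<lbrakk>A \<in> compactly_inside \<Omega>; A \<subseteq> U; z \<in> y ` A - (y ` frontier A \<union> y ` frontier U)\<rbrakk>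
       \<Longrightarrow> degree_on y A z \<le> 1"
    and degree_on_eq_1: "\<And>A z. \<lbrakk>interior (y ` frontier U) = {}; A \<in> compactly_inside \<Omega>; A \<subseteq> U;
       z \<in> y ` A - y ` frontier A\<rbrakk> \<Longrightarrow> degree_on y A z = 1"
    and fibre_reduced_connected: "\<And>z. z \<notin> y ` frontier U \<Longrightarrow> connected (reduced_domain \<Omega> y U \<inter> y -` {z})"
    and reduced_domain_eq: "im_loc \<Omega> y U \<inter> y ` frontier U = {} \<Longrightarrow>
      reduced_domain \<Omega> y U = U - y -` (y ` frontier U)"
    and im_loc_eq: "im_loc \<Omega> y U \<inter> y ` frontier U = {} \<Longrightarrow> im_loc \<Omega> y U = y ` U - y ` frontier U"
    and im_T_eq: "im_loc \<Omega> y U \<inter> y ` frontier U = {} \<Longrightarrow> y ` U - y ` frontier U = im_T y U"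
    and frontier_im_loc: "im_loc \<Omega> y U \<inter> y ` frontier U = {} \<Longrightarrow> y ` frontier U = frontier (im_loc \<Omega> y U)"
proof -
  have op: "orientation_preserving_on \<Omega> y"
    using y by (simp add: strictly_orientation_preserving_on_def)
  show le1: "degree_on y A z \<le> 1"
    if "A \<in> compactly_inside \<Omega>" "A \<subseteq> U" "z \<in> y ` A - (y ` frontier A \<union> y ` frontier U)" for A z
    using that degree_on_mono [OF op U, of z A] deg [of z] by (auto simp: compactly_inside_def)
  show "degree_on y A z = 1"
    if int: "interior (y ` frontier U) = {}" and A: "A \<in> compactly_inside \<Omega>" "A \<subseteq> U" and z: "z \<in> y ` A - y ` frontier A"
    for A z
  proof -
    note A' = compactly_insideD [OF A(1) y(2)]
    have pos: "degree_on y A z \<ge> 1"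
      using degree_on_pos [OF y A'] z by blast
    obtain e where e: "e > 0" "\<And>w. w \<in> ball z e \<Longrightarrow> w \<notin> y ` frontier A"
        "\<And>w. w \<in> ball z e \<Longrightarrow> degree_on y A w = degree_on y A z"
      using degree_on_locally_constant [OF A'(1,2,4), of z] z by (metis DiffD2)
    have "\<not> ball z e \<subseteq> y ` frontier U"
      using int e(1) interior_maximal [of "ball z e" "y ` frontier U"] by auto
    then obtain w where w: "w \<in> ball z e" "w \<notin> y ` frontier U"
      by blast
    then have "degree_on y A w \<le> 1"
      using e(2) degree_on_mono [OF op U, of w A] deg [of w] A A'(1) by fastforce
    with pos e(3) [OF w(1)] show ?thesis
      by simp
  qed
  have red: "reduced_domain \<Omega> y U \<inter> y -` {z} = U \<inter> y -` {z}" if "z \<notin> y ` frontier U" for z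
    using that reduced_domainI [OF U] by (auto simp: reduced_domain_def)
  show "connected (reduced_domain \<Omega> y U \<inter> y -` {z})" if "z \<notin> y ` frontier U" for z
    unfolding red [OF that] by (rule fibre_connected [OF y U that deg [OF that]])
  assume disj: "im_loc \<Omega> y U \<inter> y ` frontier U = {}"
  have "reduced_domain \<Omega> y U \<subseteq> U - y -` (y ` frontier U)"
  proof
    fix x assume x: "x \<in> reduced_domain \<Omega> y U"
    then have "y x \<notin> y ` frontier U"
      using disj reduced_domain_image_im_loc [OF y x] by blast
    with x show "x \<in> U - y -` (y ` frontier U)"
      by (simp add: reduced_domain_def)
  qed
  moreover have "U - y -` (y ` frontier U) \<subseteq> reduced_domain \<Omega> y U"
    using reduced_domainI [OF U] by blast
  ultimately have 1: "reduced_domain \<Omega> y U = U - y -` (y ` frontier U)"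
    by simp
  have 2: "im_loc \<Omega> y U = y ` U - y ` frontier U"
  proof
    show "im_loc \<Omega> y U \<subseteq> y ` U - y ` frontier U"
      using im_loc_subset_image [OF y(2)] disj by blast
    show "y ` U - y ` frontier U \<subseteq> im_loc \<Omega> y U"
    proof
      fix z assume "z \<in> y ` U - y ` frontier U"
      then obtain x where "x \<in> reduced_domain \<Omega> y U" "z = y x"
        unfolding 1 by blast
      then show "z \<in> im_loc \<Omega> y U"
        using reduced_domain_image_im_loc [OF y] by blast
    qed
  qed
  have 3: "y ` U - y ` frontier U = im_T y U"
  proof
    show "y ` U - y ` frontier U \<subseteq> im_T y U"
    proof
      fix z assume z: "z \<in> y ` U - y ` frontier U"
      then have "degree_on y U z \<ge> 1"
        using degree_on_pos [OF y U] by blast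
      then show "z \<in> im_T y U"
        using z by (simp add: im_T_def)
    qed
    show "im_T y U \<subseteq> y ` U - y ` frontier U"
      using degree_on_nonzero_imp_image [OF U(1,2,4)] by (auto simp: im_T_def)
  qed
  have "open (im_loc \<Omega> y U)"
    using open_im_T [OF U(1,2,4)] 2 3 by simp
  then have fr: "frontier (im_loc \<Omega> y U) = closure (im_loc \<Omega> y U) - im_loc \<Omega> y U"
    by (simp add: frontier_def interior_open)
  have "compact (y ` closure U)"
    using U by (intro compact_continuous_image) auto
  then have "closure (im_loc \<Omega> y U) \<subseteq> y ` closure U"
    using 2 closure_subset [of U] by (intro closure_minimal) (auto simp: compact_imp_closed)
  also have "\<dots> \<subseteq> y ` U \<union> y ` frontier U"
    using U by (auto simp: frontier_def interior_open)
  also have "\<dots> = im_loc \<Omega> y U \<union> y ` frontier U"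
    by (simp add: 2)
  finally have "frontier (im_loc \<Omega> y U) \<subseteq> y ` frontier U"
    unfolding fr by (simp add: Diff_subset_conv)
  moreover have "y x \<in> closure (im_loc \<Omega> y U)" if x: "x \<in> frontier U" for x
    unfolding closure_approachable
  proof (intro allI impI)
    fix e :: real assume "e > 0"
    then obtain A z where "A \<in> compactly_inside \<Omega>" "A \<subseteq> U \<inter> UNIV" "z \<notin> y ` frontier A"
        "degree_on y A z \<ge> 1" "z \<in> ball (y x) e"
      using exists_degree_on_pos_near_frontier [OF y U(1,3,4) x open_UNIV UNIV_I] by metis
    then show "\<exists>z \<in> im_loc \<Omega> y U. dist z (y x) < e"
      by (intro bexI [of _ z]) (auto simp: im_loc_def im_T_def dist_commute)
  qed
  then have "y ` frontier U \<subseteq> frontier (im_loc \<Omega> y U)"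
    unfolding fr using disj by auto
  ultimately have 4: "y ` frontier U = frontier (im_loc \<Omega> y U)"
    by (rule subset_antisym [rotated])
  show "reduced_domain \<Omega> y U = U - y -` (y ` frontier U)"
    "im_loc \<Omega> y U = y ` U - y ` frontier U"
    "y ` U - y ` frontier U = im_T y U"
    "y ` frontier U = frontier (im_loc \<Omega> y U)"
    by (fact 1 2 3 4)+
qed

theorem theorem38:
  fixes \<Omega> U :: "(real ^ 'n) set" and y :: "real ^ 'n \<Rightarrow> real ^ 'n"
  assumes "CARD('n) \<ge> 2"
    and "open \<Omega>"
    and "continuous_on \<Omega> y"
    and "strictly_orientation_preserving_on \<Omega> y"
    and "U \<in> compactly_inside \<Omega> \<or> (U = \<Omega> \<and> bounded \<Omega> \<and> continuous_on (closure \<Omega>) y)"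
    and "\<forall>z. z \<notin> y ` frontier U \<longrightarrow> degree_on y U z \<le> 1"
  shows "(\<forall>A \<in> compactly_inside \<Omega>. A \<subseteq> U \<longrightarrow>
            (\<forall>z \<in> y ` A - y ` frontier A. degree_on y A z \<ge> 1) \<and>
            (\<forall>z \<in> y ` A - (y ` frontier A \<union> y ` frontier U). degree_on y A z \<le> 1) \<and>
            (interior (y ` frontier U) = {} \<longrightarrow>
              (\<forall>z \<in> y ` A - y ` frontier A. degree_on y A z = 1))) \<and>
         (\<forall>z \<in> im_loc \<Omega> y U - y ` frontier U. connected (reduced_domain \<Omega> y U \<inter> y -` {z})) \<and>
         (interior (y ` frontier U) = {} \<longrightarrow> im_loc \<Omega> y U \<inter> y ` frontier U = {}) \<and>
         (im_loc \<Omega> y U \<inter> y ` frontier U = {} \<longrightarrow>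
            reduced_domain \<Omega> y U = U - y -` (y ` frontier U) \<and>
            im_loc \<Omega> y U = y ` U - y ` frontier U \<and>
            y ` U - y ` frontier U = im_T y U \<and>
            y ` frontier U = frontier (im_loc \<Omega> y U))"
proof -
  note y = assms(4) assms(3)
  have "open U \<and> bounded U \<and> U \<subseteq> \<Omega> \<and> continuous_on (closure U) y"
    using assms(5)
  proof
    assume "U \<in> compactly_inside \<Omega>"
    from compactly_insideD [OF this assms(3)] show ?thesis by (intro conjI)
  next
    assume "U = \<Omega> \<and> bounded \<Omega> \<and> continuous_on (closure \<Omega>) y"
    with assms(2) show ?thesis by simp
  qed
  then have U: "open U" "bounded U" "U \<subseteq> \<Omega>" "continuous_on (closure U) y"
    by simp_all
  have deg: "degree_on y U z \<le> 1" if "z \<notin> y ` frontier U" for z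
    using assms(6) that by blast
  show ?thesis
  proof (intro conjI ballI impI)
    fix A assume A: "A \<in> compactly_inside \<Omega>" "A \<subseteq> U"
    show "degree_on y A z \<ge> 1" if "z \<in> y ` A - y ` frontier A" for z
      using that degree_on_pos [OF y compactly_insideD [OF A(1) assms(3)]] by blast
    show "degree_on y A z \<le> 1" if "z \<in> y ` A - (y ` frontier A \<union> y ` frontier U)" for z
      by (rule degree_on_le_1 [OF y U deg A that])
    show "degree_on y A z = 1" if "interior (y ` frontier U) = {}" "z \<in> y ` A - y ` frontier A" for z
      by (rule degree_on_eq_1 [OF y U deg that(1) A that(2)])
  next
    show "connected (reduced_domain \<Omega> y U \<inter> y -` {z})" if "z \<in> im_loc \<Omega> y U - y ` frontier U" for z
      using that by (intro fibre_reduced_connected [OF y U deg]) simp_all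
    show "im_loc \<Omega> y U \<inter> y ` frontier U = {}" if "interior (y ` frontier U) = {}"
      by (rule im_loc_disjoint_image_frontier [OF y U deg that])
    assume disj: "im_loc \<Omega> y U \<inter> y ` frontier U = {}"
    show "reduced_domain \<Omega> y U = U - y -` (y ` frontier U)"
      by (rule reduced_domain_eq [OF y U deg disj])
    show "im_loc \<Omega> y U = y ` U - y ` frontier U"
      by (rule im_loc_eq [OF y U deg disj])
    show "y ` U - y ` frontier U = im_T y U"
      by (rule im_T_eq [OF y U deg disj])
    show "y ` frontier U = frontier (im_loc \<Omega> y U)"
      by (rule frontier_im_loc [OF y U deg disj])
  qed
qed

end
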